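(* Let $K$ be a field of characteristic different from $2$, let $f(x)\in K[x]$ be a separable polynomial of even degree $d\ge6$ whose Galois group over $K$ is the full symmetric group $S_d$, and let $L$ be its splitting field over $K$. Assume that the discriminant $\Delta$ of $f$ does not lie in $-K^2=\{-a^2: a\in K\}$. Let $\alpha_1,\dots,\alpha_d\in L$ be the roots of $f$. Then the images in $L^\times/(L^\times)^2$ of the elements $\alpha_j-\alpha_i$, $1\le i<j\le d$, form an independent set in the multiplicative group $L^\times/(L^\times)^2$ (viewed as an $\mathbb F_2$-vector space); i.e. no product of the elements of a nonempty subset of $\{\alpha_j-\alpha_i\}_{1\le i<j\le d}$ is a square in $L$. *)

theory Defs
  imports
    "HOL-Algebra.Algebraic_Closure_Type"
    "HOL-Algebra.Generated_Fields"
    "HOL-Algebra.Coset"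
    "HOL-Combinatorics.Permutations"
begin

text \<open>
  A field extension \<open>L / K\<close> is given by two types of class \<open>field\<close> and an embedding
  \<open>\<iota> :: 'k \<Rightarrow> 'l\<close> of \<open>K\<close> into \<open>L\<close>; injectivity is automatic for a homomorphism of fields.
  Notions of HOL-Algebra are applied to the types through \<^const>\<open>ring_of_type_algebra\<close>.
\<close>

definition poly_roots_in :: "('k::Fields.field \<Rightarrow> 'l::Fields.field) \<Rightarrow> 'k poly \<Rightarrow> 'l set" where
  "poly_roots_in \<iota> f = {x. poly (map_poly \<iota> f) x = 0}"

definition is_splitting_field :: "('k::Fields.field \<Rightarrow> 'l::Fields.field) \<Rightarrow> 'k poly \<Rightarrow> bool" where
  "is_splitting_field \<iota> f \<longleftrightarrow>
     \<iota> \<in> ring_hom ring_of_type_algebra ring_of_type_algebra \<and>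
     (\<exists>A. map_poly \<iota> f = Polynomial.smult (\<iota> (lead_coeff f)) (\<Prod>a\<in>#A. [:- a, 1:])) \<and>
     generate_field ring_of_type_algebra (range \<iota> \<union> poly_roots_in \<iota> f) = UNIV"

definition galois_automorphisms ::
    "('k::Fields.field \<Rightarrow> 'l::Fields.field) \<Rightarrow> ('l \<Rightarrow> 'l) set" where
  "galois_automorphisms \<iota> =
     {\<sigma> \<in> ring_iso ring_of_type_algebra ring_of_type_algebra. \<forall>a. \<sigma> (\<iota> a) = \<iota> a}"

text \<open>
  The Galois group of a polynomial is regarded as a permutation group on the roots; it is the full
  symmetric group if every permutation of the roots is the restriction of an automorphism.
\<close>

definition galois_group_full_symmetric ::
    "('k::Fields.field \<Rightarrow> 'l::Fields.field) \<Rightarrow> 'k poly \<Rightarrow> bool" where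
  "galois_group_full_symmetric \<iota> f \<longleftrightarrow>
     (\<lambda>\<sigma> x. if x \<in> poly_roots_in \<iota> f then \<sigma> x else x) ` galois_automorphisms \<iota> =
     {\<pi>. \<pi> permutes poly_roots_in \<iota> f}"

definition index_pairs :: "nat \<Rightarrow> (nat \<times> nat) set" where
  "index_pairs d = {(i, j). 1 \<le> i \<and> i < j \<and> j \<le> d}"

text \<open>
  The discriminant of a polynomial of degree \<open>d\<close> with leading coefficient \<open>c\<close> and roots
  \<open>\<alpha> 1, \<dots>, \<alpha> d\<close>, as an element of the field containing the roots.
\<close>

definition discriminant :: "'l::Fields.field \<Rightarrow> nat \<Rightarrow> (nat \<Rightarrow> 'l) \<Rightarrow> 'l" where
  "discriminant c d \<alpha> = c ^ (2 * d - 2) * (\<Prod>(i, j)\<in>index_pairs d. (\<alpha> j - \<alpha> i)\<^sup>2)"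

definition nonzero_squares :: "'l::Fields.field set" where
  "nonzero_squares = {y\<^sup>2 | y. y \<noteq> 0}"

definition nonzero_group :: "'l::Fields.field monoid" where
  "nonzero_group = \<lparr>carrier = UNIV - {0}, monoid.mult = (*), one = 1\<rparr>"

definition square_class_group :: "'l::Fields.field set monoid" where
  "square_class_group = nonzero_group Mod nonzero_squares"

definition square_class :: "'l::Fields.field \<Rightarrow> 'l set" where
  "square_class x = nonzero_squares #>\<^bsub>nonzero_group\<^esub> x"

text \<open>
  Linear independence over \<open>\<bbbF>\<^sub>2\<close> of a family in a commutative group of exponent dividing 2, written
  multiplicatively: the scalars are the exponents 0 and 1.
\<close>

definition F2_independent :: "('g, 'm) monoid_scheme \<Rightarrow> 'i set \<Rightarrow> ('i \<Rightarrow> 'g) \<Rightarrow> bool" where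
  "F2_independent G I v \<longleftrightarrow>
     (\<forall>S c. finite S \<and> S \<subseteq> I \<and> (\<forall>i\<in>S. c i \<in> {0, 1::nat}) \<and>
        finprod G (\<lambda>i. v i [^]\<^bsub>G\<^esub> c i) S = \<one>\<^bsub>G\<^esub> \<longrightarrow> (\<forall>i\<in>S. c i = 0))"

lemma nonzero_group_simps [simp]:
  "carrier (nonzero_group :: 'l::Fields.field monoid) = UNIV - {0}"
  "monoid.mult (nonzero_group :: 'l monoid) = (*)"
  "one (nonzero_group :: 'l monoid) = 1"
  by (simp_all add: nonzero_group_def)

lemma comm_group_nonzero_group: "comm_group (nonzero_group :: 'l::Fields.field monoid)"
proof (rule comm_groupI)
  fix x :: 'l assume "x \<in> carrier nonzero_group"
  then show "\<exists>y\<in>carrier nonzero_group. y \<otimes>\<^bsub>nonzero_group\<^esub> x = \<one>\<^bsub>nonzero_group\<^esub>"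
    by (intro bexI[of _ "inverse x"]) auto
qed (auto simp: mult_ac)

lemma subgroup_nonzero_squares:
  "subgroup nonzero_squares (nonzero_group :: 'l::Fields.field monoid)"
proof -
  interpret G: comm_group "nonzero_group :: 'l monoid"
    by (rule comm_group_nonzero_group)
  show ?thesis
  proof (rule G.subgroupI)
    show "nonzero_squares \<noteq> ({} :: 'l set)"
      by (auto simp: nonzero_squares_def intro: exI[of _ 1])
  next
    fix a :: 'l assume "a \<in> nonzero_squares"
    then obtain y where y: "a = y\<^sup>2" "y \<noteq> 0" by (auto simp: nonzero_squares_def)
    have "inv\<^bsub>nonzero_group\<^esub> a = (inverse y)\<^sup>2"
      using y by (intro G.inv_equality) (auto simp: power_inverse)
    with y show "inv\<^bsub>nonzero_group\<^esub> a \<in> nonzero_squares"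
      by (auto simp: nonzero_squares_def intro!: exI[of _ "inverse y"])
  next
    fix a b :: 'l assume "a \<in> nonzero_squares" "b \<in> nonzero_squares"
    then obtain y z where "a = y\<^sup>2" "y \<noteq> 0" "b = z\<^sup>2" "z \<noteq> 0"
      by (auto simp: nonzero_squares_def)
    then show "a \<otimes>\<^bsub>nonzero_group\<^esub> b \<in> nonzero_squares"
      by (auto simp: nonzero_squares_def power_mult_distrib intro!: exI[of _ "y * z"])
  qed (auto simp: nonzero_squares_def)
qed

lemma comm_group_square_class_group:
  "comm_group (square_class_group :: 'l::Fields.field set monoid)"
  unfolding square_class_group_def
  by (rule comm_group.abelian_FactGroup[OF comm_group_nonzero_group subgroup_nonzero_squares])

end

theory Submission
  imports Defs
begin

text \<open>
  Write \<open>\<delta> = \<Prod>i<j. (\<alpha> j - \<alpha> i)\<close>. The fixed field of the transpositions is \<open>K\<close>, and \<open>-\<Delta>\<close> is not a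
  square in \<open>K\<close>, so no square root of \<open>-\<delta>\<^sup>2\<close> in \<open>L\<close> is fixed by all transpositions. As \<open>\<delta>\<close> is negated
  by every transposition, a square root of \<open>-1\<close> in \<open>L\<close> is therefore fixed by all of them.

  View a set of differences as a graph on the roots. The graphs whose product is a square up to sign
  are closed under symmetric difference and under permutations. From a nonempty one this produces
  the complete graph, a four-cycle, or the complete bipartite graph between two vertices and all
  the others. Each is impossible. If \<open>\<delta> = \<plusminus>y\<^sup>2\<close> and \<open>t\<close> is a transposition, then \<open>t y / y\<close> is a square
  root of \<open>-1\<close> negated by \<open>t\<close>. If four-cycles give squares, the product of the square roots for
  the three four-cycles on \<open>{a, b, c, e}\<close>, divided by the Vandermonde product, is a square root of
  \<open>-1\<close> negated by \<open>(a b)\<close>. In the bipartite case \<open>f'(\<alpha> a) f'(\<alpha> b)\<close> is a square for all \<open>a \<noteq> b\<close>; as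
  \<open>d\<close> is even, multiplying such square roots gives a square root of \<open>\<plusminus>\<delta>\<^sup>2\<close> that is fixed by one
  transposition and hence by all.
\<close>

section \<open>Fixed elements of a Galois extension with symmetric group\<close>

definition ring_endo :: "('l::Fields.field \<Rightarrow> 'l) \<Rightarrow> bool" where
  "ring_endo \<sigma> \<longleftrightarrow> \<sigma> 1 = 1 \<and> (\<forall>x y. \<sigma> (x + y) = \<sigma> x + \<sigma> y) \<and> (\<forall>x y. \<sigma> (x * y) = \<sigma> x * \<sigma> y)"

lemma
  assumes "ring_endo \<sigma>"
  shows ring_endo_1: "\<sigma> 1 = 1"
    and ring_endo_add: "\<sigma> (x + y) = \<sigma> x + \<sigma> y"
    and ring_endo_mult: "\<sigma> (x * y) = \<sigma> x * \<sigma> y"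
  using assms by (simp_all add: ring_endo_def)

lemma ring_endo_0: "ring_endo \<sigma> \<Longrightarrow> \<sigma> 0 = 0"
  using ring_endo_add[of \<sigma> 0 0] by (metis add.right_neutral add_left_cancel)

lemma ring_endo_minus: "ring_endo \<sigma> \<Longrightarrow> \<sigma> (- x) = - \<sigma> x"
  using ring_endo_add[of \<sigma> x "- x"] ring_endo_0[of \<sigma>]
  by (simp add: eq_neg_iff_add_eq_0 add.commute)

lemma ring_endo_neq_0: "ring_endo \<sigma> \<Longrightarrow> x \<noteq> 0 \<Longrightarrow> \<sigma> x \<noteq> 0"
  using ring_endo_mult[of \<sigma> x "inverse x"] ring_endo_1[of \<sigma>] by auto

lemma ring_endo_inverse: "ring_endo \<sigma> \<Longrightarrow> \<sigma> (inverse x) = inverse (\<sigma> x)"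
  using ring_endo_mult[of \<sigma> x "inverse x"] ring_endo_1[of \<sigma>] ring_endo_0[of \<sigma>]
  by (cases "x = 0") (auto intro: inverse_unique[symmetric])

lemma ring_endo_inj: "ring_endo \<sigma> \<Longrightarrow> inj \<sigma>"
proof (rule injI)
  fix x y assume \<sigma>: "ring_endo \<sigma>" and "\<sigma> x = \<sigma> y"
  moreover have "\<sigma> (x + - y) = \<sigma> x + \<sigma> (- y)"
    by (rule ring_endo_add[OF \<sigma>])
  ultimately have "\<sigma> (x + - y) = 0"
    by (simp only: ring_endo_minus[OF \<sigma>] add.right_inverse)
  then show "x = y" using ring_endo_neq_0[OF \<sigma>, of "x + - y"] by auto
qed

lemma ring_endo_power: "ring_endo \<sigma> \<Longrightarrow> \<sigma> (x ^ n) = \<sigma> x ^ n"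
  by (induction n) (simp_all add: ring_endo_1 ring_endo_mult)

lemma ring_endo_sum: "ring_endo \<sigma> \<Longrightarrow> \<sigma> (sum f A) = (\<Sum>i\<in>A. \<sigma> (f i))"
  by (induction A rule: infinite_finite_induct) (simp_all add: ring_endo_0 ring_endo_add)

lemma ring_endo_prod: "ring_endo \<sigma> \<Longrightarrow> \<sigma> (prod f A) = (\<Prod>i\<in>A. \<sigma> (f i))"
  by (induction A rule: infinite_finite_induct) (simp_all add: ring_endo_1 ring_endo_mult)

section \<open>Subrings of a field, polynomials over them, and adjunction of one element\<close>

definition subring_set :: "'l::Fields.field set \<Rightarrow> bool" where
  "subring_set R \<longleftrightarrow> 1 \<in> R \<and> (\<forall>x\<in>R. - x \<in> R) \<and>
    (\<forall>x\<in>R. \<forall>y\<in>R. x + y \<in> R) \<and> (\<forall>x\<in>R. \<forall>y\<in>R. x * y \<in> R)"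

definition poly_over :: "'l::Fields.field set \<Rightarrow> 'l poly \<Rightarrow> bool" where
  "poly_over R p \<longleftrightarrow> (\<forall>n. poly.coeff p n \<in> R)"

text \<open>This is the ring \<open>R[a]\<close>, built without inverses; that adjoining all roots
  still yields a field is shown in \<open>tower_eq_UNIV\<close>.\<close>

definition adjoin :: "'l::Fields.field set \<Rightarrow> 'l \<Rightarrow> 'l set" where
  "adjoin R a = {poly p a | p. poly_over R p}"

context
  fixes R :: "'l::Fields.field set"
  assumes R: "subring_set R"
begin

lemma subring_set_1: "1 \<in> R"
  and subring_set_minus: "x \<in> R \<Longrightarrow> - x \<in> R"
  and subring_set_add: "x \<in> R \<Longrightarrow> y \<in> R \<Longrightarrow> x + y \<in> R"
  and subring_set_mult: "x \<in> R \<Longrightarrow> y \<in> R \<Longrightarrow> x * y \<in> R"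
  using R by (auto simp: subring_set_def)

lemma subring_set_0: "0 \<in> R"
  using subring_set_1 subring_set_minus subring_set_add by (metis add.right_inverse)

lemma subring_set_power: "x \<in> R \<Longrightarrow> x ^ n \<in> R"
  by (induction n) (auto simp: subring_set_1 subring_set_mult)

lemma subring_set_sum: "(\<And>i. i \<in> A \<Longrightarrow> f i \<in> R) \<Longrightarrow> sum f A \<in> R"
  by (induction A rule: infinite_finite_induct) (auto simp: subring_set_0 subring_set_add)

lemma subring_set_prod: "(\<And>i. i \<in> A \<Longrightarrow> f i \<in> R) \<Longrightarrow> prod f A \<in> R"
  by (induction A rule: infinite_finite_induct) (auto simp: subring_set_1 subring_set_mult)

lemma poly_over_const: "c \<in> R \<Longrightarrow> poly_over R [:c:]"
  by (auto simp: poly_over_def coeff_pCons subring_set_0 split: nat.splits)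

lemma poly_over_linear: "a \<in> R \<Longrightarrow> b \<in> R \<Longrightarrow> poly_over R [:a, b:]"
  by (auto simp: poly_over_def coeff_pCons subring_set_0 split: nat.splits)

lemma poly_over_minus: "poly_over R p \<Longrightarrow> poly_over R (- p)"
  by (auto simp: poly_over_def subring_set_minus)

lemma poly_over_add: "poly_over R p \<Longrightarrow> poly_over R q \<Longrightarrow> poly_over R (p + q)"
  by (auto simp: poly_over_def subring_set_add)

lemma poly_over_mult: "poly_over R p \<Longrightarrow> poly_over R q \<Longrightarrow> poly_over R (p * q)"
  by (auto simp: poly_over_def coeff_mult intro!: subring_set_sum subring_set_mult)

lemma poly_over_monom: "c \<in> R \<Longrightarrow> poly_over R (Polynomial.monom c n)"
  by (auto simp: poly_over_def subring_set_0)

lemma poly_in_adjoin: "poly_over R p \<Longrightarrow> poly p a \<in> adjoin R a"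
  unfolding adjoin_def by blast

lemma subset_adjoin: "R \<subseteq> adjoin R a"
  using poly_in_adjoin[OF poly_over_const] by auto

lemma gen_in_adjoin: "a \<in> adjoin R a"
  using poly_in_adjoin[OF poly_over_linear[OF subring_set_0 subring_set_1], of a] by simp

lemma subring_set_adjoin: "subring_set (adjoin R a)"
  unfolding subring_set_def
proof (intro conjI ballI)
  show "1 \<in> adjoin R a" using subset_adjoin subring_set_1 by blast
next
  fix x assume "x \<in> adjoin R a"
  then obtain p where "poly_over R p" "x = poly p a" by (auto simp: adjoin_def)
  then show "- x \<in> adjoin R a"
    using poly_in_adjoin[OF poly_over_minus, of p a] by simp
next
  fix x y assume "x \<in> adjoin R a" "y \<in> adjoin R a"
  then obtain p q where pq: "poly_over R p" "x = poly p a" "poly_over R q" "y = poly q a"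
    by (auto simp: adjoin_def)
  show "x + y \<in> adjoin R a"
    using poly_in_adjoin[OF poly_over_add[OF pq(1,3)], of a] pq by simp
  show "x * y \<in> adjoin R a"
    using poly_in_adjoin[OF poly_over_mult[OF pq(1,3)], of a] pq by simp
qed

text \<open>The coefficient of \<open>q\<close> at \<open>n\<close> is that of the product at
  \<open>Suc n\<close> plus \<open>a\<close> times that of \<open>q\<close> at \<open>Suc n\<close>,
  so membership in \<open>R\<close> passes down from the top coefficient.\<close>

lemma poly_over_cofactor:
  assumes a: "a \<in> R" and p: "poly_over R ([:- a, 1:] * q)"
  shows "poly_over R q"
proof -
  have step: "poly.coeff q n \<in> R" if "poly.coeff q (Suc n) \<in> R" for n
  proof -
    have "poly.coeff ([:- a, 1:] * q) (Suc n) = poly.coeff q n - a * poly.coeff q (Suc n)"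
      by simp
    then have "poly.coeff q n = poly.coeff ([:- a, 1:] * q) (Suc n) + a * poly.coeff q (Suc n)"
      by (simp only: diff_add_cancel)
    moreover have "poly.coeff ([:- a, 1:] * q) (Suc n) \<in> R"
      using p unfolding poly_over_def by blast
    ultimately show ?thesis
      using subring_set_add subring_set_mult[OF a that] by metis
  qed
  have "poly.coeff q n \<in> R" for n
  \<comment> \<open>The induction runs downwards from the first index beyond the degree, where the
    coefficients vanish.\<close>
  proof (induction "Suc (Polynomial.degree q) - n" arbitrary: n)
    case 0
    then show ?case by (simp add: coeff_eq_0 subring_set_0)
  next
    case (Suc k)
    then have "poly.coeff q (Suc n) \<in> R" by simp
    then show ?case by (rule step)
  qed
  then show ?thesis by (simp add: poly_over_def)
qed

text \<open>Division with remainder works over a mere ring because \<open>h\<close> is monic. The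
  remainder is described by its values at the roots of \<open>h\<close>, the form in which it is
  used.\<close>

lemma reduce_mod_monic:
  assumes h: "poly_over R h" "lead_coeff h = 1" "Polynomial.degree h > 0" and p: "poly_over R p"
  shows "\<exists>r. poly_over R r \<and> Polynomial.degree r < Polynomial.degree h \<and>
    (\<forall>x. poly h x = 0 \<longrightarrow> poly r x = poly p x)"
  using p
proof (induction "Polynomial.degree p" arbitrary: p rule: less_induct)
  case less
  show ?case
  proof (cases "Polynomial.degree p < Polynomial.degree h")
    case True
    then show ?thesis using less.prems by blast
  next
    case False
    define k where "k = Polynomial.degree p - Polynomial.degree h"
    \<comment> \<open>As \<open>h\<close> is monic, \<open>u\<close> has the degree and leading
      coefficient of \<open>p\<close>, so subtracting it lowers the degree; it vanishes at the roots
      of \<open>h\<close>.\<close>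
    define u where "u = Polynomial.monom (lead_coeff p) k * h"
    define q where "q = p - u"
    have [simp]: "p \<noteq> 0" using False h(3) by auto
    have "h \<noteq> 0" using h(3) by auto
    then have u: "Polynomial.degree u = Polynomial.degree p"
      unfolding u_def using False
      by (simp add: degree_mult_eq monom_eq_0_iff degree_monom_eq k_def)
    have lc: "lead_coeff u = lead_coeff p"
      unfolding u_def lead_coeff_mult h(2) by (simp add: degree_monom_eq)
    have "poly_over R q"
      using less.prems h(1) poly_over_add poly_over_minus poly_over_mult poly_over_monom
      unfolding q_def u_def by (metis diff_conv_add_uminus poly_over_def)
    moreover have "Polynomial.degree q < Polynomial.degree p"
    proof (cases "q = 0")
      case True
      then show ?thesis using False h(3) by simp
    next
      case False
      show ?thesis
      proof (rule degree_less_if_less_eqI)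
        show "Polynomial.degree q \<le> Polynomial.degree p"
          unfolding q_def using u by (intro degree_diff_le) auto
        show "poly.coeff q (Polynomial.degree p) = 0"
          unfolding q_def using u lc by simp
      qed (rule False)
    qed
    moreover have "poly q x = poly p x" if "poly h x = 0" for x
      using that by (simp add: q_def u_def)
    ultimately show ?thesis using less.hyps by metis
  qed
qed

lemma ring_endo_poly:
  assumes "ring_endo \<sigma>" "poly_over R p" "\<And>x. x \<in> R \<Longrightarrow> \<sigma> x = x"
  shows "\<sigma> (poly p x) = poly p (\<sigma> x)"
  using assms by (simp add: poly_altdef ring_endo_sum ring_endo_mult ring_endo_power poly_over_def)

lemma ring_endo_poly_in_subring_set:
  assumes "ring_endo \<sigma>" "poly_over R' p" "\<And>x. x \<in> R' \<Longrightarrow> \<sigma> x \<in> R" "\<sigma> x \<in> R"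
  shows "\<sigma> (poly p x) \<in> R"
  using assms by (simp add: poly_altdef ring_endo_sum ring_endo_mult ring_endo_power poly_over_def)
    (auto intro!: subring_set_sum subring_set_mult subring_set_power)

text \<open>Reduced modulo \<open>h\<close>, the polynomial expressing \<open>x\<close> takes the value \<open>x\<close> at all \<open>\<alpha> i\<close>,
  more points than its degree, so it is constant.\<close>

lemma fixed_in_adjoin:
  assumes I: "finite I" "inj_on \<alpha> I" "m \<in> I"
    and h: "poly_over R (\<Prod>i\<in>I. [:- \<alpha> i, 1:])"
    and x: "x \<in> adjoin R (\<alpha> m)"
    and \<sigma>: "\<And>i. i \<in> I \<Longrightarrow>
      ring_endo (\<sigma> i) \<and> (\<forall>y\<in>R. \<sigma> i y = y) \<and> \<sigma> i (\<alpha> m) = \<alpha> i \<and> \<sigma> i x = x"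
  shows "x \<in> R"
proof -
  let ?h = "\<Prod>i\<in>I. [:- \<alpha> i, 1:]"
  have deg: "Polynomial.degree ?h = card I"
    by (subst degree_prod_eq_sum_degree) auto
  have lc: "lead_coeff ?h = 1"
    by (subst lead_coeff_prod) simp
  have roots: "poly ?h (\<alpha> i) = 0" if "i \<in> I" for i
    using that I(1) by (auto simp: poly_prod)
  have card: "card I > 0" using I by (auto simp: card_gt_0_iff)
  obtain p where p: "poly_over R p" "x = poly p (\<alpha> m)"
    using x by (auto simp: adjoin_def)
  then obtain r where r: "poly_over R r" "Polynomial.degree r < card I" "poly r (\<alpha> m) = x"
    using reduce_mod_monic[OF h lc _ p(1)] deg card roots[OF I(3)] by auto
  \<comment> \<open>Apply \<open>\<sigma> i\<close> to \<open>poly r (\<alpha> m) = x\<close>: it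
    fixes \<open>x\<close> and the coefficients of \<open>r\<close>, and sends
    \<open>\<alpha> m\<close> to \<open>\<alpha> i\<close>.\<close>
  have ri: "poly r (\<alpha> i) = x" if "i \<in> I" for i
    using ring_endo_poly[OF _ r(1), of "\<sigma> i" "\<alpha> m"] \<sigma>[OF that] r(3) by auto
  have "r - [:x:] = 0"
  proof (rule ccontr)
    assume nz: "r - [:x:] \<noteq> 0"
    have "\<alpha> ` I \<subseteq> {y. poly (r - [:x:]) y = 0}" using ri by auto
    then have "card I \<le> card {y. poly (r - [:x:]) y = 0}"
      using card_mono[OF poly_roots_finite[OF nz]] card_image[OF I(2)] by metis
    also have "\<dots> \<le> Polynomial.degree (r - [:x:])"
      by (rule card_poly_roots_bound[OF nz])
    also have "\<dots> < card I"
      using r(2) card by (intro degree_diff_less) auto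
    finally show False by simp
  qed
  then have "poly.coeff r 0 = x" by simp
  then show ?thesis using r(1) by (auto simp: poly_over_def)
qed

end

section \<open>The tower of rings generated over \<open>K\<close> by the first \<open>m\<close>
  roots\<close>

fun tower :: "'l::Fields.field set \<Rightarrow> (nat \<Rightarrow> 'l) \<Rightarrow> nat \<Rightarrow> 'l set" where
  "tower K \<alpha> 0 = K"
| "tower K \<alpha> (Suc m) = adjoin (tower K \<alpha> m) (\<alpha> (Suc m))"

lemma subring_set_tower: "subring_set K \<Longrightarrow> subring_set (tower K \<alpha> m)"
  by (induction m) (auto intro: subring_set_adjoin)

lemma tower_mono: "subring_set K \<Longrightarrow> m \<le> n \<Longrightarrow> tower K \<alpha> m \<subseteq> tower K \<alpha> n"
proof (rule lift_Suc_mono_le[of "tower K \<alpha>"])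
  show "tower K \<alpha> k \<subseteq> tower K \<alpha> (Suc k)" if "subring_set K" for k
    using subset_adjoin[OF subring_set_tower[OF that]] by simp
qed

lemma root_in_tower:
  assumes "subring_set K" "i \<in> {1..m}"
  shows "\<alpha> i \<in> tower K \<alpha> m"
proof -
  obtain k where "i = Suc k" using assms(2) by (cases i) auto
  then have "\<alpha> i \<in> tower K \<alpha> i"
    using gen_in_adjoin[OF subring_set_tower] assms(1) by auto
  then show ?thesis using tower_mono[OF assms(1), of i m] assms(2) by auto
qed

lemma ring_endo_fixes_tower:
  assumes K: "subring_set K" and \<sigma>: "ring_endo \<sigma>" "\<And>x. x \<in> K \<Longrightarrow> \<sigma> x = x"
    and "\<And>i. i \<in> {1..m} \<Longrightarrow> \<sigma> (\<alpha> i) = \<alpha> i" and "x \<in> tower K \<alpha> m"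
  shows "\<sigma> x = x"
  using assms(4-)
proof (induction m arbitrary: x)
  case 0
  then show ?case using \<sigma> by simp
next
  case (Suc m)
  then obtain p where "poly_over (tower K \<alpha> m) p" "x = poly p (\<alpha> (Suc m))"
    by (auto simp: adjoin_def)
  then show ?case
    using ring_endo_poly[OF subring_set_tower[OF K] \<sigma>(1)] Suc by simp
qed

lemma ring_endo_tower_subset:
  assumes K: "subring_set K" and R: "subring_set R" and \<sigma>: "ring_endo \<sigma>" "\<And>x. x \<in> K \<Longrightarrow> \<sigma> x \<in> R"
    and "\<And>i. i \<in> {1..m} \<Longrightarrow> \<sigma> (\<alpha> i) \<in> R" and "x \<in> tower K \<alpha> m"
  shows "\<sigma> x \<in> R"
  using assms(5-)
proof (induction m arbitrary: x)
  case 0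
  then show ?case using \<sigma> by simp
next
  case (Suc m)
  then obtain p where "poly_over (tower K \<alpha> m) p" "x = poly p (\<alpha> (Suc m))"
    by (auto simp: adjoin_def)
  then show ?case
    using ring_endo_poly_in_subring_set[OF R \<sigma>(1)] Suc by simp
qed

text \<open>Dividing off the linear factors of the adjoined roots one by one leaves a polynomial
  over the current ring whose roots are the remaining ones. It serves as the polynomial
  \<open>h\<close> of \<open>fixed_in_adjoin\<close>.\<close>

lemma poly_over_tower:
  assumes K: "subring_set K" and h: "poly_over K (\<Prod>i\<in>{1..d}. [:- \<alpha> i, 1:])" and "m \<le> d"
  shows "poly_over (tower K \<alpha> m) (\<Prod>i\<in>{Suc m..d}. [:- \<alpha> i, 1:])"
  using assms(3)
proof (induction m)
  case 0
  then show ?case using h by simp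
next
  case (Suc m)
  let ?R = "tower K \<alpha> (Suc m)"
  have "(\<Prod>i\<in>{Suc m..d}. [:- \<alpha> i, 1:]) = [:- \<alpha> (Suc m), 1:] * (\<Prod>i\<in>{Suc (Suc m)..d}. [:- \<alpha> i, 1:])"
    using Suc.prems by (subst prod.atLeast_Suc_atMost) auto
  moreover have "poly_over ?R (\<Prod>i\<in>{Suc m..d}. [:- \<alpha> i, 1:])"
    using Suc tower_mono[OF K, of m "Suc m"] by (auto simp: poly_over_def simp del: tower.simps)
  moreover have "\<alpha> (Suc m) \<in> ?R"
    by (rule root_in_tower[OF K]) simp
  ultimately show ?case
    using poly_over_cofactor[OF subring_set_tower[OF K]] by metis
qed

text \<open>The base field is a subset of the large field, so that only one type is involved;
  \<open>g \<pi>\<close> is the automorphism inducing \<open>\<pi>\<close> on the indices of the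
  roots.\<close>

locale symmetric_galois =
  fixes K :: "'l::Fields.field set" and \<alpha> :: "nat \<Rightarrow> 'l" and d :: nat
    and g :: "(nat \<Rightarrow> nat) \<Rightarrow> 'l \<Rightarrow> 'l"
  assumes K: "subring_set K" and K_inverse: "x \<in> K \<Longrightarrow> inverse x \<in> K"
    and inj_\<alpha>: "inj_on \<alpha> {1..d}"
    and over_K: "poly_over K (\<Prod>i\<in>{1..d}. [:- \<alpha> i, 1:])"
    and g_endo: "\<pi> permutes {1..d} \<Longrightarrow> ring_endo (g \<pi>)"
    and g_K: "\<pi> permutes {1..d} \<Longrightarrow> x \<in> K \<Longrightarrow> g \<pi> x = x"
    and g_\<alpha>: "\<pi> permutes {1..d} \<Longrightarrow> i \<in> {1..d} \<Longrightarrow> g \<pi> (\<alpha> i) = \<alpha> (\<pi> i)"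
    and g_compose: "\<pi> permutes {1..d} \<Longrightarrow> \<rho> permutes {1..d} \<Longrightarrow> g (\<pi> \<circ> \<rho>) x = g \<pi> (g \<rho> x)"
    and g_ident: "g id x = x"
    and generated: "\<And>F. subring_set F \<Longrightarrow> (\<And>x. x \<in> F \<Longrightarrow> inverse x \<in> F) \<Longrightarrow> K \<subseteq> F \<Longrightarrow>
      \<alpha> ` {1..d} \<subseteq> F \<Longrightarrow> F = UNIV"
begin

text \<open>The transpositions exchanging \<open>Suc m\<close> with a later index fix the first
  \<open>m\<close> roots and carry \<open>\<alpha> (Suc m)\<close> to every remaining root, so
  \<open>fixed_in_adjoin\<close> lets \<open>x\<close> descend one level.\<close>

lemma fixed_in_tower:
  assumes fixed: "\<And>a b. a \<in> {1..d} \<Longrightarrow> b \<in> {1..d} \<Longrightarrow> g (transpose a b) x = x"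
    and "m \<le> d" "x \<in> tower K \<alpha> m"
  shows "x \<in> K"
  using assms(2-)
proof (induction m)
  case (Suc m)
  have "x \<in> tower K \<alpha> m"
  proof (rule fixed_in_adjoin[OF subring_set_tower[OF K], where I = "{Suc m..d}" and m = "Suc m"
        and \<alpha> = \<alpha> and \<sigma> = "\<lambda>i. g (transpose (Suc m) i)"])
    show "x \<in> adjoin (tower K \<alpha> m) (\<alpha> (Suc m))" using Suc by simp
    show "poly_over (tower K \<alpha> m) (\<Prod>i\<in>{Suc m..d}. [:- \<alpha> i, 1:])"
      using poly_over_tower[OF K over_K] Suc by simp
    show "inj_on \<alpha> {Suc m..d}" by (rule inj_on_subset[OF inj_\<alpha>]) auto
    fix i assume i: "i \<in> {Suc m..d}"
    let ?t = "transpose (Suc m) i"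
    have t: "?t permutes {1..d}" using i Suc.prems by (intro permutes_swap_id) auto
    have "g ?t y = y" if "y \<in> tower K \<alpha> m" for y
      by (rule ring_endo_fixes_tower[OF K g_endo[OF t] g_K[OF t] _ that])
        (use g_\<alpha>[OF t] i in \<open>auto simp: transpose_def\<close>)
    then show "ring_endo (g ?t) \<and> (\<forall>y\<in>tower K \<alpha> m. g ?t y = y) \<and>
        g ?t (\<alpha> (Suc m)) = \<alpha> i \<and> g ?t x = x"
      using g_endo[OF t] g_\<alpha>[OF t] fixed[of "Suc m" i] i by auto
  qed (use Suc in auto)
  then show ?case using Suc by simp
qed simp

text \<open>The product of the conjugates of \<open>b\<close> lies in \<open>K\<close>, so \<open>b\<close> is invertible in the ring
  generated by \<open>K\<close> and the roots.\<close>

lemma tower_eq_UNIV: "tower K \<alpha> d = UNIV"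
proof (rule generated)
  let ?R = "tower K \<alpha> d"
  show R: "subring_set ?R" by (rule subring_set_tower[OF K])
  show "K \<subseteq> ?R" using tower_mono[OF K, of 0 d] by simp
  show "\<alpha> ` {1..d} \<subseteq> ?R" using root_in_tower[OF K] by auto
  show "inverse b \<in> ?R" if b: "b \<in> ?R" for b
  proof (cases "b = 0")
    case False
    \<comment> \<open>The conjugates of \<open>b\<close> form a set, each counted once; the
      automorphisms permute it, so its product is fixed.\<close>
    define B where "B = (\<lambda>\<pi>. g \<pi> b) ` {\<pi>. \<pi> permutes {1..d}}"
    have finB: "finite B" unfolding B_def by (simp add: finite_permutations)
    have bB: "b \<in> B"
      unfolding B_def by (rule image_eqI[of _ _ id]) (simp_all add: g_ident permutes_id)
    have B0: "0 \<notin> B"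
    proof -
      have "g \<pi> b \<noteq> 0" if "\<pi> permutes {1..d}" for \<pi>
        by (rule ring_endo_neq_0[OF g_endo[OF that] False])
      then show ?thesis by (force simp: B_def)
    qed
    have B_sub: "B \<subseteq> ?R"
    proof -
      have "g \<pi> b \<in> ?R" if \<pi>: "\<pi> permutes {1..d}" for \<pi>
      proof (rule ring_endo_tower_subset[OF K R g_endo[OF \<pi>] _ _ b])
        show "g \<pi> (\<alpha> i) \<in> ?R" if "i \<in> {1..d}" for i
          using g_\<alpha>[OF \<pi> that] permutes_in_image[OF \<pi>, of i] that root_in_tower[OF K, of "\<pi> i" d]
          by simp
      qed (use g_K[OF \<pi>] \<open>K \<subseteq> ?R\<close> in auto)
      then show ?thesis by (auto simp: B_def)
    qed
    have "prod (\<lambda>x. x) B \<in> K"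
    proof (rule fixed_in_tower)
      fix i j assume ij: "i \<in> {1..d}" "j \<in> {1..d}"
      let ?t = "transpose i j"
      have t: "?t permutes {1..d}" using ij by (rule permutes_swap_id)
      have inj: "inj_on (g ?t) B" using ring_endo_inj[OF g_endo[OF t]] by (rule inj_on_subset) simp
      have "g ?t ` B \<subseteq> B"
        unfolding B_def using g_compose[OF t] permutes_compose[OF _ t] by (force simp: image_iff)
      then have image_B: "g ?t ` B = B"
        using finB inj by (simp add: endo_inj_surj)
      have "g ?t (prod (\<lambda>x. x) B) = (\<Prod>x\<in>B. g ?t x)"
        by (rule ring_endo_prod[OF g_endo[OF t]])
      also have "\<dots> = prod (\<lambda>x. x) (g ?t ` B)"
        using prod.reindex[OF inj, of "\<lambda>x. x"] by (simp add: comp_def)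
      finally show "g ?t (prod (\<lambda>x. x) B) = prod (\<lambda>x. x) B"
        by (simp only: image_B)
    next
      show "prod (\<lambda>x. x) B \<in> ?R" using B_sub by (intro subring_set_prod[OF R]) auto
    qed simp
    then have "inverse (prod (\<lambda>x. x) B) \<in> ?R"
      using K_inverse \<open>K \<subseteq> ?R\<close> by blast
    moreover have "prod (\<lambda>x. x) (B - {b}) \<in> ?R"
      using B_sub by (intro subring_set_prod[OF R]) auto
    moreover have "inverse b = prod (\<lambda>x. x) (B - {b}) * inverse (prod (\<lambda>x. x) B)"
    proof -
      have "prod (\<lambda>x. x) (B - {b}) \<noteq> 0" using finB B0 by auto
      then show ?thesis
        using prod.remove[OF finB bB, of "\<lambda>x. x"] False by (simp add: field_simps)
    qed
    ultimately show ?thesis using subring_set_mult[OF R] by simp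
  qed (use subring_set_0[OF R] in simp)
qed

text \<open>The tower reaches the whole field, so the descent applies to every element.\<close>

lemma fixed_in_base:
  assumes "\<And>a b. a \<in> {1..d} \<Longrightarrow> b \<in> {1..d} \<Longrightarrow> g (transpose a b) x = x"
  shows "x \<in> K"
  using fixed_in_tower[OF assms, of d] tower_eq_UNIV by simp

end

section \<open>The action of the symmetric group on differences of roots\<close>

text \<open>Signs are ignored because a permutation may reverse the order of two indices and with it
  the sign of their difference.\<close>

definition eq_upto_sign :: "'l::Fields.field \<Rightarrow> 'l \<Rightarrow> bool" where
  "eq_upto_sign x y \<longleftrightarrow> x = y \<or> x = - y"

definition square_upto_sign :: "'l::Fields.field \<Rightarrow> bool" where
  "square_upto_sign x \<longleftrightarrow> (\<exists>y. eq_upto_sign x (y\<^sup>2))"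

lemma eq_upto_sign_mult:
  "eq_upto_sign x y \<Longrightarrow> eq_upto_sign x' y' \<Longrightarrow> eq_upto_sign (x * x') (y * y')"
  by (auto simp: eq_upto_sign_def)

lemma eq_upto_sign_prod:
  assumes "\<And>i. i \<in> I \<Longrightarrow> eq_upto_sign (x i) (y i)"
  shows "eq_upto_sign (prod x I) (prod y I)"
  using assms
proof (induction I rule: infinite_finite_induct)
  case (insert i I)
  then show ?case by (simp add: eq_upto_sign_mult)
qed (auto simp: eq_upto_sign_def)

lemma eq_upto_sign_sym: "eq_upto_sign x y \<Longrightarrow> eq_upto_sign y x"
  by (auto simp: eq_upto_sign_def)

lemma eq_upto_sign_trans: "eq_upto_sign x y \<Longrightarrow> eq_upto_sign y z \<Longrightarrow> eq_upto_sign x z"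
  by (auto simp: eq_upto_sign_def)

lemma eq_upto_sign_iff_power2: "eq_upto_sign x y \<longleftrightarrow> x\<^sup>2 = y\<^sup>2"
  by (simp add: eq_upto_sign_def power2_eq_iff)

lemma square_upto_sign_cong: "eq_upto_sign x y \<Longrightarrow> square_upto_sign x \<Longrightarrow> square_upto_sign y"
  unfolding square_upto_sign_def using eq_upto_sign_sym eq_upto_sign_trans by blast

lemma square_upto_sign_mult:
  "square_upto_sign x \<Longrightarrow> square_upto_sign y \<Longrightarrow> square_upto_sign (x * y)"
  unfolding square_upto_sign_def by (metis eq_upto_sign_mult power_mult_distrib)

lemma square_upto_sign_cancel:
  assumes "square_upto_sign (x * y\<^sup>2)" "y \<noteq> 0"
  shows "square_upto_sign x"
proof -
  obtain z where "eq_upto_sign (x * y\<^sup>2) (z\<^sup>2)"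
    using assms(1) by (auto simp: square_upto_sign_def)
  then have "eq_upto_sign x ((z / y)\<^sup>2)"
    using assms(2) by (auto simp: eq_upto_sign_def power_divide field_simps)
  then show ?thesis by (auto simp: square_upto_sign_def)
qed

text \<open>Multiplying the three equations makes \<open>-1\<close> the square of
  \<open>m * n * k / (x * y * z)\<close>, and then the negative of a square is itself a
  square.\<close>

lemma square_if_pairwise_neg_squares:
  fixes x y z :: "'l::Fields.field"
  assumes "x * y = - (m\<^sup>2)" "y * z = - (n\<^sup>2)" "x * z = - (k\<^sup>2)" "x \<noteq> 0" "y \<noteq> 0" "z \<noteq> 0"
  shows "\<exists>w. x * y = w\<^sup>2"
proof -
  have "(m * n * k)\<^sup>2 = - ((- (m\<^sup>2)) * (- (n\<^sup>2)) * (- (k\<^sup>2)))"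
    by (simp add: power_mult_distrib)
  also have "\<dots> = - ((x * y * z)\<^sup>2)"
    by (simp only: assms(1-3)[symmetric]) (simp add: power2_eq_square)
  finally have "(m * n * k / (x * y * z))\<^sup>2 = -1"
    using assms(4-) by (simp add: power_divide)
  then have "(m * (m * n * k / (x * y * z)))\<^sup>2 = x * y"
    using assms(1) by (simp only: power_mult_distrib) simp
  then show ?thesis by metis
qed

text \<open>Only the permutation action is kept, without a base field: the condition on the
  discriminant becomes \<open>root_neg_disc_not_fixed\<close>. The order on the indices fixes the
  signs of the differences.\<close>

locale symmetric_action =
  fixes V :: "'i::linorder set" and \<alpha> :: "'i \<Rightarrow> 'l::Fields.field"
    and g :: "('i \<Rightarrow> 'i) \<Rightarrow> 'l \<Rightarrow> 'l"
  assumes finite_V: "finite V" and card_ge: "card V \<ge> 6" and card_even: "even (card V)"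
    and two_neq_0: "(2 :: 'l) \<noteq> 0"
    and inj: "inj_on \<alpha> V"
    and g_add: "\<pi> permutes V \<Longrightarrow> g \<pi> (x + y) = g \<pi> x + g \<pi> y"
    and g_mult: "\<pi> permutes V \<Longrightarrow> g \<pi> (x * y) = g \<pi> x * g \<pi> y"
    and g_1: "\<pi> permutes V \<Longrightarrow> g \<pi> 1 = 1"
    and g_root: "\<pi> permutes V \<Longrightarrow> i \<in> V \<Longrightarrow> g \<pi> (\<alpha> i) = \<alpha> (\<pi> i)"
    and g_comp: "\<pi> permutes V \<Longrightarrow> \<rho> permutes V \<Longrightarrow> g (\<pi> \<circ> \<rho>) x = g \<pi> (g \<rho> x)"
    and g_id: "g id x = x"
    and root_neg_disc_not_fixed:
      "z\<^sup>2 = - (\<Prod>(i, j)\<in>{(i, j). i \<in> V \<and> j \<in> V \<and> i < j}. \<alpha> j - \<alpha> i)\<^sup>2 \<Longrightarrow>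
        \<exists>a\<in>V. \<exists>b\<in>V. g (transpose a b) z \<noteq> z"
begin

definition pairs :: "('i \<times> 'i) set" where
  "pairs = {(i, j). i \<in> V \<and> j \<in> V \<and> i < j}"

definition \<delta> :: 'l where
  "\<delta> = (\<Prod>(i, j)\<in>pairs. \<alpha> j - \<alpha> i)"

lemma finite_pairs: "finite pairs"
  by (rule finite_subset[of _ "V \<times> V"]) (auto simp: pairs_def finite_V)

lemma transpose_permutes [simp]: "a \<in> V \<Longrightarrow> b \<in> V \<Longrightarrow> transpose a b permutes V"
  by (rule permutes_swap_id)

lemma g_0: "\<pi> permutes V \<Longrightarrow> g \<pi> 0 = 0"
  using g_add[of \<pi> 0 0] by (metis add.right_neutral add_left_cancel)

lemma g_minus: "\<pi> permutes V \<Longrightarrow> g \<pi> (- x) = - g \<pi> x"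
  using g_add[of \<pi> x "- x"] g_0 by (simp add: eq_neg_iff_add_eq_0 add.commute)

lemma g_diff: "\<pi> permutes V \<Longrightarrow> g \<pi> (x - y) = g \<pi> x - g \<pi> y"
  using g_add[of \<pi> x "- y"] g_minus by simp

lemma g_power: "\<pi> permutes V \<Longrightarrow> g \<pi> (x ^ n) = g \<pi> x ^ n"
  by (induction n) (auto simp: g_1 g_mult)

lemma g_prod: "\<pi> permutes V \<Longrightarrow> g \<pi> (prod f A) = (\<Prod>i\<in>A. g \<pi> (f i))"
  by (induction A rule: infinite_finite_induct) (auto simp: g_1 g_mult)

lemma g_eq_0_iff: "\<pi> permutes V \<Longrightarrow> g \<pi> x = 0 \<longleftrightarrow> x = 0"
  by (metis g_1 g_0 g_mult right_inverse zero_neq_one mult_zero_left)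

lemma g_divide: "\<pi> permutes V \<Longrightarrow> g \<pi> (x / y) = g \<pi> x / g \<pi> y"
  using g_mult[of \<pi> "x / y" y] g_eq_0_iff[of \<pi> y] g_0 by (cases "y = 0") (auto simp: field_simps)

lemmas g_simps = g_add g_minus g_diff g_mult g_power g_prod g_divide g_1 g_0 g_root

lemma g_eq_upto_sign:
  "\<pi> permutes V \<Longrightarrow> eq_upto_sign x y \<Longrightarrow> eq_upto_sign (g \<pi> x) (g \<pi> y)"
  by (auto simp: eq_upto_sign_def g_minus)

lemma g_square_upto_sign:
  "\<pi> permutes V \<Longrightarrow> square_upto_sign x \<Longrightarrow> square_upto_sign (g \<pi> x)"
  unfolding square_upto_sign_def by (metis g_eq_upto_sign g_power)

lemma g_commute:
  assumes "\<pi> permutes V" "\<rho> permutes V" "\<pi> \<circ> \<rho> = \<rho> \<circ> \<pi>"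
  shows "g \<pi> (g \<rho> x) = g \<rho> (g \<pi> x)"
  by (metis assms g_comp)

lemma g_transpose_transpose:
  "a \<in> V \<Longrightarrow> b \<in> V \<Longrightarrow> g (transpose a b) (g (transpose a b) x) = x"
  by (metis g_comp g_id transpose_comp_involutory transpose_permutes)

lemma diff_neq_0: "i \<in> V \<Longrightarrow> j \<in> V \<Longrightarrow> i \<noteq> j \<Longrightarrow> \<alpha> i - \<alpha> j \<noteq> 0"
  using inj by (auto simp: inj_on_def)

lemma \<delta>_neq_0: "\<delta> \<noteq> 0"
  using diff_neq_0 finite_pairs by (force simp: \<delta>_def pairs_def)

lemma neq_minus: "x \<noteq> 0 \<Longrightarrow> x \<noteq> - (x :: 'l)"
  using two_neq_0 by (metis add.right_inverse mult_2 mult_eq_0_iff)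

lemma obtain_other:
  assumes "length xs \<le> 5"
  obtains v where "v \<in> V" "v \<notin> set xs"
proof -
  have "card (set xs) < card V"
    using assms card_ge card_length[of xs] by linarith
  then have "\<not> V \<subseteq> set xs"
    by (meson List.finite_set card_mono leD)
  then show ?thesis using that by blast
qed

text \<open>All transpositions are conjugate, and the action on \<open>z\<close> is through a sign character.\<close>

lemma fixed_by_transpositions:
  assumes z: "\<And>\<pi>. \<pi> permutes V \<Longrightarrow> eq_upto_sign (g \<pi> z) z"
    and ab: "a \<in> V" "b \<in> V" "a \<noteq> b" "g (transpose a b) z = z"
    and ce: "c \<in> V" "e \<in> V"
  shows "g (transpose c e) z = z"
proof (cases "c = e")
  case True
  then show ?thesis by (simp add: g_id)
next
  case False
  \<comment> \<open>After \<open>a\<close> is moved to \<open>c\<close>, the image of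
    \<open>b\<close> is \<open>b'\<close>; moving \<open>b'\<close> to \<open>e\<close> then makes
    \<open>s\<close> carry \<open>a\<close>, \<open>b\<close> to \<open>c\<close>,
    \<open>e\<close>.\<close>
  define b' where "b' = transpose a c b"
  have b': "b' \<in> V" "b' \<noteq> c"
    using ab ce by (auto simp: b'_def transpose_def)
  define s where "s = transpose b' e \<circ> transpose a c"
  define s' where "s' = transpose a c \<circ> transpose b' e"
  have s: "s permutes V" "s' permutes V"
    unfolding s_def s'_def using ab ce b' by (auto intro: permutes_compose)
  have "s \<circ> transpose a b \<circ> s' = transpose c e"
    using False ab b'(2) by (auto simp: fun_eq_iff s_def s'_def b'_def transpose_def)
  then have "g (transpose c e) z = g s (g (transpose a b) (g s' z))"
    using s ab by (metis g_comp permutes_compose transpose_permutes)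
  \<comment> \<open>\<open>g s' z\<close> is \<open>z\<close> or \<open>- z\<close>, and
    \<open>transpose a b\<close> fixes both.\<close>
  also have "\<dots> = g s (g s' z)"
    using z[OF s(2)] ab by (auto simp: eq_upto_sign_def g_minus)
  also have "\<dots> = z"
  proof -
    have "s \<circ> s' = id"
      by (auto simp: s_def s'_def fun_eq_iff)
    then show ?thesis using s g_comp g_id by metis
  qed
  finally show ?thesis .
qed

lemma eq_upto_sign_if_power2_fixed:
  "\<pi> permutes V \<Longrightarrow> g \<pi> (z\<^sup>2) = z\<^sup>2 \<Longrightarrow> eq_upto_sign (g \<pi> z) z"
  by (simp add: eq_upto_sign_iff_power2 g_power)

section \<open>Edges, and products of root differences over sets of edges\<close>

definition E :: "'i set set" where
  "E = {Y. Y \<subseteq> V \<and> card Y = 2}"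

text \<open>An edge has no orientation; the order chooses the one that makes \<open>D {i, j}\<close>
  equal to \<open>\<alpha> j - \<alpha> i\<close> for \<open>i < j\<close>.\<close>

definition D :: "'i set \<Rightarrow> 'l" where
  "D Y = \<alpha> (Max Y) - \<alpha> (Min Y)"

lemma E_iff: "Y \<in> E \<longleftrightarrow> (\<exists>u v. Y = {u, v} \<and> u \<in> V \<and> v \<in> V \<and> u \<noteq> v)"
  by (auto simp: E_def card_2_iff)

lemma finite_E: "finite E"
  by (rule finite_subset[of _ "Pow V"]) (auto simp: E_def finite_V)

lemma D_eq_upto_sign: "eq_upto_sign (D {u, v}) (\<alpha> u - \<alpha> v)"
  by (auto simp: D_def eq_upto_sign_def max_def min_def)

lemma D_neq_0: "Y \<in> E \<Longrightarrow> D Y \<noteq> 0"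
  using diff_neq_0 by (auto simp: E_iff D_def max_def min_def)

lemma g_D: "\<pi> permutes V \<Longrightarrow> Y \<in> E \<Longrightarrow> eq_upto_sign (g \<pi> (D Y)) (D (\<pi> ` Y))"
proof -
  assume \<pi>: "\<pi> permutes V" and "Y \<in> E"
  then obtain u v where Y: "Y = {u, v}" "u \<in> V" "v \<in> V" by (auto simp: E_iff)
  have "eq_upto_sign (g \<pi> (D Y)) (g \<pi> (\<alpha> u - \<alpha> v))"
    using \<pi> Y D_eq_upto_sign g_eq_upto_sign by blast
  moreover have "eq_upto_sign (\<alpha> (\<pi> u) - \<alpha> (\<pi> v)) (D (\<pi> ` Y))"
    using Y D_eq_upto_sign eq_upto_sign_sym by auto
  ultimately show ?thesis
    using \<pi> Y by (simp add: g_diff g_root) (meson eq_upto_sign_trans)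
qed

lemma image_in_E: "\<pi> permutes V \<Longrightarrow> Y \<in> E \<Longrightarrow> \<pi> ` Y \<in> E"
  unfolding E_def by (auto simp: permutes_in_image card_image permutes_inj_on)

text \<open>Increasing pairs suit the final statement, unordered edges the action of permutations;
  this identifies the two.\<close>

lemma bij_betw_pairs_E: "bij_betw (\<lambda>(i, j). {i, j}) pairs E"
proof (rule bij_betwI')
  fix p q assume "p \<in> pairs" "q \<in> pairs"
  then show "(case p of (i, j) \<Rightarrow> {i, j}) = (case q of (i, j) \<Rightarrow> {i, j}) \<longleftrightarrow> p = q"
    by (auto simp: pairs_def doubleton_eq_iff)
next
  fix Y assume "Y \<in> E"
  then obtain u v where "Y = {u, v}" "u \<in> V" "v \<in> V" "u \<noteq> v" by (auto simp: E_iff)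
  then show "\<exists>p\<in>pairs. Y = (case p of (i, j) \<Rightarrow> {i, j})"
    by (cases u v rule: linorder_cases) (auto simp: pairs_def)
qed (auto simp: pairs_def E_iff)

lemma prod_pairs_eq_prod_D:
  assumes "S \<subseteq> pairs"
  shows "(\<Prod>(i, j)\<in>S. \<alpha> j - \<alpha> i) = prod D ((\<lambda>(i, j). {i, j}) ` S)"
proof -
  have "inj_on (\<lambda>(i, j). {i, j}) S"
    using bij_betw_pairs_E assms by (meson bij_betw_def inj_on_subset)
  then have "prod D ((\<lambda>(i, j). {i, j}) ` S) = (\<Prod>(i, j)\<in>S. D {i, j})"
    by (simp add: prod.reindex case_prod_unfold comp_def)
  also have "\<dots> = (\<Prod>(i, j)\<in>S. \<alpha> j - \<alpha> i)"
    using assms by (intro prod.cong) (auto simp: pairs_def D_def)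
  finally show ?thesis by simp
qed

lemma \<delta>_eq_prod_D: "\<delta> = prod D E"
  using bij_betw_pairs_E prod_pairs_eq_prod_D[of pairs] by (simp add: \<delta>_def bij_betw_def)

lemma g_prod_D:
  assumes "\<pi> permutes V" "S \<subseteq> E"
  shows "eq_upto_sign (g \<pi> (prod D S)) (prod D ((`) \<pi> ` S))"
proof -
  have "inj_on ((`) \<pi>) S"
    by (simp add: inj_on_def inj_image_eq_iff[OF permutes_inj[OF assms(1)]])
  then have "prod D ((`) \<pi> ` S) = (\<Prod>Y\<in>S. D (\<pi> ` Y))"
    by (simp add: prod.reindex)
  then show ?thesis
    using assms by (auto simp: g_prod intro!: eq_upto_sign_prod g_D)
qed

lemma image_E: "\<pi> permutes V \<Longrightarrow> (`) \<pi> ` E = E"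
proof -
  assume \<pi>: "\<pi> permutes V"
  have "inj_on ((`) \<pi>) E"
    by (simp add: inj_on_def inj_image_eq_iff[OF permutes_inj[OF \<pi>]])
  then show ?thesis
    using \<pi> image_in_E finite_E by (intro endo_inj_surj) auto
qed

lemma g_\<delta>_eq_upto_sign: "\<pi> permutes V \<Longrightarrow> eq_upto_sign (g \<pi> \<delta>) \<delta>"
  using g_prod_D[of \<pi> E] by (simp add: \<delta>_eq_prod_D image_E)

text \<open>Exchanging the two least indices reverses no other pair, so it changes the sign of
  exactly one factor. A transposition fixing \<open>\<delta>\<close> would force this one to fix it
  too.\<close>

lemma transpose_\<delta>:
  assumes "c \<in> V" "e \<in> V" "c \<noteq> e"
  shows "g (transpose c e) \<delta> = - \<delta>"
proof (rule ccontr)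
  assume neq: "g (transpose c e) \<delta> \<noteq> - \<delta>"
  define a where "a = Min V"
  define b where "b = Min (V - {a})"
  have "V - {a} \<noteq> {}"
    using assms(1-3) by auto
  then have b: "b \<in> V" "a \<noteq> b" and b_le: "\<And>x. x \<in> V \<Longrightarrow> x \<noteq> a \<Longrightarrow> b \<le> x"
    using Min_in[of "V - {a}"] Min_le[of "V - {a}"] finite_V by (auto simp: b_def)
  have a: "a \<in> V" and a_le: "\<And>x. x \<in> V \<Longrightarrow> a \<le> x"
    using Min_in[OF finite_V] Min_le[OF finite_V] assms(1) by (auto simp: a_def)
  have ab: "a < b" using a_le[of b] b by auto
  let ?t = "transpose a b"
  let ?P = "pairs - {(a, b)}"
  have mem: "(a, b) \<in> pairs" using a b ab by (auto simp: pairs_def)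
  have mem_P: "map_prod ?t ?t p \<in> ?P" if p: "p \<in> ?P" for p
  proof -
    obtain i j where ij: "p = (i, j)" by force
    have *: "i \<in> V" "j \<in> V" "i < j" "\<not> (i = a \<and> j = b)" using p ij by (auto simp: pairs_def)
    have "?t i \<in> V" "?t j \<in> V" using * a b by (simp_all add: transpose_def)
    moreover have "?t i < ?t j"
      using * a_le[of j] a_le[of i] b_le[of i] b_le[of j] ab
      by (auto simp: transpose_def)
    moreover have "\<not> (?t i = a \<and> ?t j = b)"
      using * ab by (auto simp: transpose_def split: if_splits)
    ultimately show ?thesis
      by (auto simp: ij pairs_def)
  qed
  have "g ?t \<delta> = (\<Prod>(i, j)\<in>pairs. \<alpha> (?t j) - \<alpha> (?t i))"
    unfolding \<delta>_def using a b by (auto simp: g_simps pairs_def intro!: prod.cong)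
  also have "\<dots> = (\<alpha> a - \<alpha> b) * (\<Prod>(i, j)\<in>?P. \<alpha> (?t j) - \<alpha> (?t i))"
    using mem finite_pairs by (simp add: prod.remove[of _ "(a, b)"])
  also have "(\<Prod>(i, j)\<in>?P. \<alpha> (?t j) - \<alpha> (?t i)) = (\<Prod>(i, j)\<in>?P. \<alpha> j - \<alpha> i)"
    by (rule prod.reindex_bij_witness[of _ "map_prod ?t ?t" "map_prod ?t ?t"])
      (use mem_P in \<open>auto simp: map_prod_def split: prod.splits simp del: Diff_iff\<close>)
  also have "(\<alpha> a - \<alpha> b) * (\<Prod>(i, j)\<in>?P. \<alpha> j - \<alpha> i) = - \<delta>"
    unfolding \<delta>_def using mem finite_pairs
    by (simp add: prod.remove[of _ "(a, b)"] algebra_simps)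
  finally have ab': "g ?t \<delta> = - \<delta>" .
  have "g (transpose c e) \<delta> = \<delta>"
    using neq g_\<delta>_eq_upto_sign[of "transpose c e"] assms by (auto simp: eq_upto_sign_def)
  then have "g ?t \<delta> = \<delta>"
    using fixed_by_transpositions[OF g_\<delta>_eq_upto_sign assms] a b by blast
  then show False
    using ab' neq_minus \<delta>_neq_0 by metis
qed

text \<open>If one transposition negates \<open>i\<close>, all do. As all negate
  \<open>\<delta>\<close> as well, \<open>i * \<delta>\<close> is then a square root of minus the
  square of \<open>\<delta>\<close> fixed by every transposition.\<close>

lemma sqrt_minus_one_fixed:
  assumes i: "i\<^sup>2 = -1" and ab: "a \<in> V" "b \<in> V"
  shows "g (transpose a b) i = i"
proof (rule ccontr)
  assume neq: "g (transpose a b) i \<noteq> i"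
  have pm: "\<pi> permutes V \<Longrightarrow> eq_upto_sign (g \<pi> i) i" for \<pi>
    by (rule eq_upto_sign_if_power2_fixed) (auto simp: i g_simps)
  have moved: "g (transpose c e) i = - i" if "c \<in> V" "e \<in> V" "c \<noteq> e" for c e
    using fixed_by_transpositions[OF pm that] neq ab pm[of "transpose c e"] that
    by (auto simp: eq_upto_sign_def)
  have "(i * \<delta>)\<^sup>2 = - \<delta>\<^sup>2"
    by (simp add: power_mult_distrib i)
  then obtain c e where ce: "c \<in> V" "e \<in> V" "g (transpose c e) (i * \<delta>) \<noteq> i * \<delta>"
    using root_neg_disc_not_fixed[of "i * \<delta>"] by (auto simp: \<delta>_def pairs_def)
  then have "c \<noteq> e" by (auto simp: g_id)
  with ce show False using moved transpose_\<delta> by (simp add: g_mult)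
qed

lemma complete_not_square: "\<not> square_upto_sign \<delta>"
proof
  assume "square_upto_sign \<delta>"
  then obtain y where y: "eq_upto_sign \<delta> (y\<^sup>2)" by (auto simp: square_upto_sign_def)
  obtain a where a: "a \<in> V" using obtain_other[of "[]"] by auto
  obtain b where b: "b \<in> V" "b \<noteq> a" using obtain_other[of "[a]"] by auto
  let ?t = "g (transpose a b)"
  have y0: "y \<noteq> 0" using y \<delta>_neq_0 by (auto simp: eq_upto_sign_def)
  have "?t (y\<^sup>2) = - y\<^sup>2"
    using y transpose_\<delta>[of a b] a b by (auto simp: eq_upto_sign_def g_minus minus_equation_iff)
  then have "(?t y)\<^sup>2 = - y\<^sup>2"
    using a b by (simp add: g_power)
  then have i: "(?t y / y)\<^sup>2 = -1" using y y0 by (simp add: power_divide)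
  then have "?t (?t y / y) = ?t y / y"
    using sqrt_minus_one_fixed a b by blast
  \<comment> \<open>A transposition is an involution, so it inverts the quotient; being fixed as
    well, the quotient would have square \<open>1\<close>.\<close>
  then have "y / ?t y = ?t y / y"
    using a b by (simp add: g_divide g_transpose_transpose)
  then have "(?t y / y)\<^sup>2 = 1"
    using y0 a b g_eq_0_iff[of "transpose a b" y] by (simp add: power2_eq_square field_simps)
  then show False using i neq_minus[of 1] by simp
qed


section \<open>Invariant square roots, and products over four-cycles\<close>

lemma transpose_comp_commute:
  assumes "\<pi> permutes V" "\<pi> p = p" "\<pi> q = q"
  shows "\<pi> \<circ> transpose p q = transpose p q \<circ> \<pi>"
proof
  fix x
  have "\<pi> x = p \<longleftrightarrow> x = p" "\<pi> x = q \<longleftrightarrow> x = q"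
    using assms permutes_inj[of \<pi> V] by (metis injD)+
  then show "(\<pi> \<circ> transpose p q) x = (transpose p q \<circ> \<pi>) x"
    using assms by (auto simp: transpose_def)
qed

text \<open>With square roots \<open>m\<close>, \<open>n\<close>, \<open>k\<close> of \<open>A p * A q\<close>, \<open>A q * A r\<close>, \<open>A p * A r\<close>, conjugate under
  permutations commuting with \<open>\<pi>\<close>, the product \<open>m * n * k\<close> is \<open>A p * A q * A r\<close> up to sign; so \<open>\<pi>\<close>
  cannot negate all three.\<close>

lemma obtain_invariant_sqrt:
  assumes pqr: "p \<in> V" "q \<in> V" "r \<in> V" "p \<noteq> q" "q \<noteq> r" "p \<noteq> r"
    and A_neq_0: "\<And>x. x \<in> {p, q, r} \<Longrightarrow> A x \<noteq> 0"
    and A_transpose: "\<And>x y z. {x, y, z} \<subseteq> {p, q, r} \<Longrightarrow> g (transpose x y) (A z) = A (transpose x y z)"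
    and sq: "square_upto_sign (A p * A q)"
  obtains m where "A p * A q = m\<^sup>2"
    and "\<And>\<pi>. \<pi> permutes V \<Longrightarrow> \<pi> p = p \<Longrightarrow> \<pi> q = q \<Longrightarrow> \<pi> r = r \<Longrightarrow>
      (\<And>x. x \<in> {p, q, r} \<Longrightarrow> g \<pi> (A x) = A x) \<Longrightarrow> g \<pi> m = m"
proof -
  let ?s = "g (transpose p r)" and ?t = "g (transpose q r)"
  have s: "?s (A p * A q) = A q * A r"
    using A_transpose[of p r p] A_transpose[of p r q] pqr by (simp add: g_mult)
  have t: "?t (A p * A q) = A p * A r"
    using A_transpose[of q r p] A_transpose[of q r q] pqr by (simp add: g_mult)
  \<comment> \<open>The minus sign is excluded: \<open>?s\<close> and \<open>?t\<close> would carry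
    it to the other two products, and the three together force a square.\<close>
  have "\<exists>m. A p * A q = m\<^sup>2"
  proof (rule ccontr)
    assume nsq: "\<nexists>m. A p * A q = m\<^sup>2"
    with sq obtain m where m: "A p * A q = - m\<^sup>2"
      by (auto simp: square_upto_sign_def eq_upto_sign_def)
    have "A q * A r = - (?s m)\<^sup>2" "A p * A r = - (?t m)\<^sup>2"
      using s t m pqr by (simp_all add: g_minus g_power)
    then show False
      using square_if_pairwise_neg_squares[OF m] nsq A_neq_0 by blast
  qed
  then obtain m where m: "A p * A q = m\<^sup>2" by blast
  define n k where "n = ?s m" and "k = ?t m"
  have nk: "n\<^sup>2 = A q * A r" "k\<^sup>2 = A p * A r"
    unfolding n_def k_def using s t m pqr by (simp_all add: g_power)
  have "(m * n * k)\<^sup>2 = (A p * A q * A r)\<^sup>2"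
    by (simp only: power_mult_distrib nk m[symmetric]) (simp add: power2_eq_square)
  then have mnk: "eq_upto_sign (m * n * k) (A p * A q * A r)"
    by (simp add: eq_upto_sign_iff_power2)
  have "g \<pi> m = m"
    if \<pi>: "\<pi> permutes V" and fixes_pqr: "\<pi> p = p" "\<pi> q = q" "\<pi> r = r"
      and A: "\<And>x. x \<in> {p, q, r} \<Longrightarrow> g \<pi> (A x) = A x" for \<pi>
  proof (rule ccontr)
    assume neq: "g \<pi> m \<noteq> m"
    have "eq_upto_sign (g \<pi> m) m"
      using \<pi> A m by (intro eq_upto_sign_if_power2_fixed) (auto simp: g_mult simp flip: m)
    with neq have neg: "g \<pi> m = - m" by (simp add: eq_upto_sign_def)
    have "g \<pi> n = - n" "g \<pi> k = - k"
      unfolding n_def k_def using \<pi> fixes_pqr pqr neg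
      by (simp_all add: g_commute[OF \<pi> _ transpose_comp_commute] g_minus)
    then have "g \<pi> (m * n * k) = - (m * n * k)"
      using neg \<pi> by (simp add: g_mult)
    moreover have "g \<pi> (A p * A q * A r) = A p * A q * A r"
      using \<pi> A by (simp add: g_mult)
    then have "g \<pi> (m * n * k) = m * n * k"
      using mnk \<pi> unfolding eq_upto_sign_def by (metis g_minus)
    moreover have "m * n * k \<noteq> 0"
      using mnk A_neq_0 by (auto simp: eq_upto_sign_def)
    ultimately show False using neq_minus by metis
  qed
  with m show ?thesis using that by blast
qed

lemma four_cycle_not_square:
  assumes V: "a \<in> V" "b \<in> V" "c \<in> V" "e \<in> V" and "distinct [a, b, c, e]"
  shows "\<not> square_upto_sign
    ((\<alpha> c - \<alpha> a) * (\<alpha> c - \<alpha> b) * ((\<alpha> e - \<alpha> a) * (\<alpha> e - \<alpha> b)))"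
proof
  \<comment> \<open>\<open>A x\<close> is the product of the edges joining \<open>x\<close> to
    \<open>a\<close> and \<open>b\<close>, so \<open>A c * A e\<close> belongs to a
    four-cycle.\<close>
  define A where "A = (\<lambda>x. (\<alpha> x - \<alpha> a) * (\<alpha> x - \<alpha> b))"
  assume "square_upto_sign ((\<alpha> c - \<alpha> a) * (\<alpha> c - \<alpha> b) * ((\<alpha> e - \<alpha> a) * (\<alpha> e - \<alpha> b)))"
  then have sq: "square_upto_sign (A c * A e)" by (simp add: A_def)
  obtain v where v: "v \<in> V" "v \<notin> {a, b, c, e}"
    using obtain_other[of "[a, b, c, e]"] by auto
  have dist: "a \<noteq> b" "a \<noteq> c" "a \<noteq> e" "b \<noteq> c" "b \<noteq> e" "c \<noteq> e" "v \<noteq> a" "v \<noteq> b" "v \<noteq> c" "v \<noteq> e"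
    using assms v by auto
  note dist = dist dist[symmetric]
  let ?t = "transpose a b"
  obtain m where m: "A c * A e = m\<^sup>2"
    and inv: "\<And>\<pi>. \<pi> permutes V \<Longrightarrow> \<pi> c = c \<Longrightarrow> \<pi> e = e \<Longrightarrow> \<pi> v = v \<Longrightarrow>
      (\<And>x. x \<in> {c, e, v} \<Longrightarrow> g \<pi> (A x) = A x) \<Longrightarrow> g \<pi> m = m"
  proof (rule obtain_invariant_sqrt[of c e v A])
    show "A x \<noteq> 0" if "x \<in> {c, e, v}" for x
      using that V v dist diff_neq_0 by (auto simp: A_def)
    show "g (transpose x y) (A z) = A (transpose x y z)" if "{x, y, z} \<subseteq> {c, e, v}" for x y z
    proof -
      have "x \<in> V" "y \<in> V" "z \<in> V" and "transpose x y a = a" "transpose x y b = b"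
        using that V v dist by (auto simp: transpose_def)
      then show ?thesis using V by (simp add: A_def g_simps)
    qed
  qed (use V v dist sq in auto)
  \<comment> \<open>\<open>?t\<close> fixes \<open>c\<close>, \<open>e\<close>, \<open>v\<close> and
    merely exchanges the two factors of each \<open>A x\<close>.\<close>
  have tm: "g ?t m = m"
    by (rule inv) (use V v dist in \<open>auto simp: A_def g_simps transpose_def mult.commute\<close>)
  \<comment> \<open>\<open>n\<close> and \<open>k\<close> are square roots for the other two
    four-cycles on the same vertices; \<open>?t\<close> exchanges them.\<close>
  define n where "n = g (transpose b c) m"
  define k where "k = g ?t n"
  have n: "n\<^sup>2 = (\<alpha> b - \<alpha> a) * (\<alpha> b - \<alpha> c) * ((\<alpha> e - \<alpha> a) * (\<alpha> e - \<alpha> c))"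
    unfolding n_def using V dist by (simp add: m[symmetric] A_def g_simps transpose_def flip: g_power)
  have k: "k\<^sup>2 = (\<alpha> a - \<alpha> b) * (\<alpha> a - \<alpha> c) * ((\<alpha> e - \<alpha> b) * (\<alpha> e - \<alpha> c))"
    unfolding k_def using V dist by (simp add: n g_simps transpose_def flip: g_power)
  \<comment> \<open>\<open>W\<close> is the product of all six differences. Each edge lies in two of
    the three four-cycles, and three reversed differences leave a minus sign in the square of
    \<open>m * n * k\<close>.\<close>
  define W where "W = (\<alpha> b - \<alpha> a) * ((\<alpha> c - \<alpha> a) * (\<alpha> c - \<alpha> b)) *
    ((\<alpha> e - \<alpha> a) * (\<alpha> e - \<alpha> b)) * (\<alpha> e - \<alpha> c)"
  have W0: "W \<noteq> 0" using diff_neq_0 V dist by (simp add: W_def)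
  have tW: "g ?t W = - W"
    using V dist by (simp add: W_def g_simps transpose_def algebra_simps)
  have "(m * n * k)\<^sup>2 = - W\<^sup>2"
  proof -
    have "\<alpha> b - \<alpha> c = - (\<alpha> c - \<alpha> b)" "\<alpha> a - \<alpha> b = - (\<alpha> b - \<alpha> a)"
      "\<alpha> a - \<alpha> c = - (\<alpha> c - \<alpha> a)"
      by simp_all
    then show ?thesis
      unfolding power_mult_distrib n k m[symmetric] A_def W_def
      by (simp only: power2_eq_square mult_minus_left mult_minus_right minus_minus mult_ac)
  qed
  then have "(m * n * k / W)\<^sup>2 = -1"
    using W0 by (simp add: power_divide)
  then have "g ?t (m * n * k / W) = m * n * k / W"
    using V by (intro sqrt_minus_one_fixed)
  moreover have "g ?t k = n"
    unfolding k_def using V by (simp add: g_transpose_transpose)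
  ultimately have "- (m * n * k / W) = m * n * k / W"
    using V tm tW by (simp add: g_mult g_divide k_def[symmetric] mult.commute mult.left_commute)
  then show False
    using neq_minus[of "m * n * k / W"] \<open>(m * n * k / W)\<^sup>2 = -1\<close> by force
qed

text \<open>Up to sign, \<open>F a\<close> is the derivative of \<open>\<Prod>c\<in>V. (X - \<alpha> c)\<close> at \<open>\<alpha> a\<close>.\<close>

definition F :: "'i \<Rightarrow> 'l" where
  "F a = (\<Prod>c\<in>V - {a}. \<alpha> c - \<alpha> a)"

lemma F_neq_0: "a \<in> V \<Longrightarrow> F a \<noteq> 0"
  using diff_neq_0 finite_V by (auto simp: F_def)

lemma g_F:
  assumes "\<pi> permutes V" "a \<in> V"
  shows "g \<pi> (F a) = F (\<pi> a)"
proof -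
  have "g \<pi> (F a) = (\<Prod>c\<in>V - {a}. \<alpha> (\<pi> c) - \<alpha> (\<pi> a))"
    unfolding F_def using assms by (auto simp: g_simps intro!: prod.cong)
  also have "\<dots> = (\<Prod>c\<in>\<pi> ` (V - {a}). \<alpha> c - \<alpha> (\<pi> a))"
    by (subst prod.reindex) (auto intro: inj_on_subset[OF permutes_inj[OF assms(1)]])
  also have "\<pi> ` (V - {a}) = V - {\<pi> a}"
    using assms by (simp add: image_set_diff permutes_inj permutes_image)
  finally show ?thesis by (simp add: F_def)
qed

text \<open>Each unordered pair contributes its difference in both orientations, and the two agree
  up to sign.\<close>

lemma prod_F: "eq_upto_sign (prod F V) (\<delta>\<^sup>2)"
proof -
  let ?d = "\<lambda>(i, j). \<alpha> j - \<alpha> i"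
  have "prod F V = prod ?d (SIGMA a:V. V - {a})"
    unfolding F_def using finite_V by (subst prod.Sigma) auto
  also have "(SIGMA a:V. V - {a}) = pairs \<union> prod.swap ` pairs"
    by (auto simp: pairs_def)
  also have "prod ?d \<dots> = prod ?d pairs * prod ?d (prod.swap ` pairs)"
    using finite_pairs by (subst prod.union_disjoint) (auto simp: pairs_def)
  also have "prod ?d (prod.swap ` pairs) = (\<Prod>(i, j)\<in>pairs. \<alpha> i - \<alpha> j)"
    by (subst prod.reindex) (auto simp: case_prod_unfold inj_on_def)
  finally have "prod F V = \<delta> * (\<Prod>(i, j)\<in>pairs. \<alpha> i - \<alpha> j)"
    by (simp add: \<delta>_def)
  moreover have "eq_upto_sign (\<Prod>(i, j)\<in>pairs. \<alpha> i - \<alpha> j) \<delta>"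
    unfolding \<delta>_def by (rule eq_upto_sign_prod) (auto simp: eq_upto_sign_def)
  ultimately show ?thesis
    by (auto simp: eq_upto_sign_def power2_eq_square)
qed

text \<open>Since \<open>card V\<close> is even, multiplying the conjugates of \<open>m\<close> gives a square root of
  \<open>prod F V\<close>; it is fixed by a transposition, unlike \<open>\<delta>\<close>.\<close>

lemma F_product_not_square:
  assumes ab: "a \<in> V" "b \<in> V" "a \<noteq> b"
  shows "\<not> square_upto_sign (F a * F b)"
proof
  assume sq: "square_upto_sign (F a * F b)"
  \<comment> \<open>\<open>r\<close> will be the third index for
    \<open>obtain_invariant_sqrt\<close>; the transposition of \<open>p\<close> and \<open>q\<close>
    moves none of \<open>a\<close>, \<open>b\<close>, \<open>r\<close>.\<close>
  obtain p where p: "p \<in> V" "p \<notin> {a, b}"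
    using obtain_other[of "[a, b]"] by auto
  obtain q where q: "q \<in> V" "q \<notin> {a, b, p}"
    using obtain_other[of "[a, b, p]"] by auto
  obtain r where r: "r \<in> V" "r \<notin> {a, b, p, q}"
    using obtain_other[of "[a, b, p, q]"] by auto
  let ?t = "transpose p q"
  obtain m where m: "F a * F b = m\<^sup>2"
    and inv: "\<And>\<pi>. \<pi> permutes V \<Longrightarrow> \<pi> a = a \<Longrightarrow> \<pi> b = b \<Longrightarrow> \<pi> r = r \<Longrightarrow>
      (\<And>x. x \<in> {a, b, r} \<Longrightarrow> g \<pi> (F x) = F x) \<Longrightarrow> g \<pi> m = m"
  proof (rule obtain_invariant_sqrt[of a b r F])
    show "g (transpose x y) (F z) = F (transpose x y z)" if "{x, y, z} \<subseteq> {a, b, r}" for x y z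
      using that ab r by (intro g_F transpose_permutes) auto
  qed (use ab r sq F_neq_0 in auto)
  have tm: "g ?t m = m"
    by (rule inv) (use ab p q r g_F[of ?t] in \<open>auto simp: transpose_def\<close>)
  \<comment> \<open>Each factor is a square root of \<open>F a * F c\<close>, obtained by moving
    \<open>b\<close> to \<open>c\<close>; the factor at \<open>c = b\<close> is \<open>m\<close>
    itself.\<close>
  define y where "y = (\<Prod>c\<in>V - {a}. g (transpose b c) m)"
  \<comment> \<open>\<open>F a\<close> occurs \<open>card V - 1\<close> times as first factor in the
    square of \<open>y\<close>; one copy completes \<open>prod F V\<close>, and the remaining even
    number is divided out.\<close>
  define h where "h = (card V - 2) div 2"
  define z where "z = y / F a ^ h"
  have "y\<^sup>2 = (\<Prod>c\<in>V - {a}. F a * F c)"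
    unfolding y_def prod_power_distrib
  proof (rule prod.cong)
    fix c assume c: "c \<in> V - {a}"
    then have "(g (transpose b c) m)\<^sup>2 = g (transpose b c) (F a * F b)"
      using ab by (simp add: m g_power)
    then show "(g (transpose b c) m)\<^sup>2 = F a * F c"
      using ab c by (cases "c = b") (auto simp: g_mult g_F)
  qed simp
  also have "\<dots> = F a ^ (card V - 2) * prod F V"
  proof -
    have "card V - 1 = Suc (card V - 2)" using card_ge by simp
    then show ?thesis
      using ab finite_V by (simp add: prod.distrib prod.remove[of V a] card_Diff_singleton mult_ac)
  qed
  also have "F a ^ (card V - 2) = (F a ^ h)\<^sup>2"
    using card_even by (simp add: h_def flip: power_mult)
  finally have z2: "z\<^sup>2 = prod F V"
    using F_neq_0 ab by (simp add: z_def power_divide)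
  have z_pm: "eq_upto_sign (g \<pi> z) z" if "\<pi> permutes V" for \<pi>
  proof (rule eq_upto_sign_if_power2_fixed[OF that])
    have "g \<pi> (prod F V) = (\<Prod>c\<in>V. F (\<pi> c))"
      using that by (simp add: g_prod g_F)
    also have "\<dots> = prod F V"
      using prod.permute[OF that, of F] by (simp add: comp_def)
    finally show "g \<pi> (z\<^sup>2) = z\<^sup>2" by (simp add: z2)
  qed
  have "g ?t y = (\<Prod>c\<in>V - {a}. g (transpose b (?t c)) m)"
  proof -
    have "g ?t (g (transpose b c) m) = g (transpose b (?t c)) m" if "c \<in> V" for c
    proof -
      \<comment> \<open>As \<open>?t\<close> fixes \<open>b\<close>, conjugating by it only replaces
        \<open>c\<close> by \<open>?t c\<close>; hence \<open>?t\<close> permutes the factors of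
        \<open>y\<close>.\<close>
      have "?t \<circ> transpose b c = transpose b (?t c) \<circ> ?t"
        using transpose_comp_eq[of ?t b c] p q by (auto simp: fun_eq_iff transpose_def)
      then have "g ?t (g (transpose b c) m) = g (transpose b (?t c)) (g ?t m)"
        using that ab p q permutes_in_image[of ?t V c]
        by (metis g_comp transpose_permutes)
      then show ?thesis by (simp add: tm)
    qed
    then show ?thesis
      unfolding y_def using p q by (simp add: g_prod)
  qed
  also have "\<dots> = y"
    unfolding y_def
    by (rule prod.reindex_bij_witness[of _ ?t ?t])
      (use p q in \<open>auto simp: transpose_def\<close>)
  finally have tz: "g ?t z = z"
    unfolding z_def using ab p q g_F[of ?t a] by (auto simp: g_divide g_power)
  \<comment> \<open>With the minus sign \<open>z\<close>, fixed by \<open>?t\<close> and hence by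
    all transpositions, violates \<open>root_neg_disc_not_fixed\<close>; with the plus sign
    \<open>z\<close> is \<open>\<delta>\<close> up to sign, which \<open>?t\<close> negates.\<close>
  have "prod F V = \<delta>\<^sup>2 \<or> prod F V = - \<delta>\<^sup>2"
    using prod_F by (simp add: eq_upto_sign_def)
  then show False
  proof
    assume "prod F V = - \<delta>\<^sup>2"
    then obtain c e where "c \<in> V" "e \<in> V" "g (transpose c e) z \<noteq> z"
      using root_neg_disc_not_fixed[of z] z2 by (auto simp: \<delta>_def pairs_def)
    then show False
      using fixed_by_transpositions[OF z_pm _ _ _ tz] p q by blast
  next
    assume "prod F V = \<delta>\<^sup>2"
    then have "z = \<delta> \<or> z = - \<delta>" using z2 by (simp add: power2_eq_iff)
    moreover have "g ?t \<delta> = - \<delta>" using transpose_\<delta> p q by blast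
    ultimately show False
      using tz neq_minus[OF \<delta>_neq_0] p q by (auto simp: g_minus)
  qed
qed

text \<open>\<open>F a * F b\<close> is this product times minus the square of
  \<open>\<alpha> b - \<alpha> a\<close>, the edge between \<open>a\<close> and \<open>b\<close>
  occurring in both factors.\<close>

lemma even_cut_not_square:
  assumes ab: "a \<in> V" "b \<in> V" "a \<noteq> b"
  shows "\<not> square_upto_sign (\<Prod>c\<in>V - {a, b}. (\<alpha> c - \<alpha> a) * (\<alpha> c - \<alpha> b))"
proof
  let ?P = "\<Prod>c\<in>V - {a, b}. (\<alpha> c - \<alpha> a) * (\<alpha> c - \<alpha> b)"
  assume sq: "square_upto_sign ?P"
  have "F a = (\<alpha> b - \<alpha> a) * (\<Prod>c\<in>V - {a, b}. \<alpha> c - \<alpha> a)"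
    unfolding F_def using ab finite_V
    by (subst prod.remove[of _ b]) (auto intro!: arg_cong2[where f = times] prod.cong)
  moreover have "F b = (\<alpha> a - \<alpha> b) * (\<Prod>c\<in>V - {a, b}. \<alpha> c - \<alpha> b)"
    unfolding F_def using ab finite_V
    by (subst prod.remove[of _ a]) (auto intro!: arg_cong2[where f = times] prod.cong)
  ultimately have "F a * F b = ?P * - ((\<alpha> b - \<alpha> a)\<^sup>2)"
    by (simp only: prod.distrib power2_eq_square minus_diff_eq[of "\<alpha> b" "\<alpha> a", symmetric]
        mult_minus_left mult_minus_right minus_minus mult_ac)
  moreover have "square_upto_sign (- ((\<alpha> b - \<alpha> a)\<^sup>2))"
    by (auto simp: square_upto_sign_def eq_upto_sign_def)
  ultimately show False
    using F_product_not_square[OF ab] square_upto_sign_mult[OF sq] by metis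
qed

subsection \<open>Graphs on the roots\<close>


text \<open>Edges common to \<open>S\<close> and \<open>T\<close> occur twice in the product of the
  two, so they contribute a nonzero square that cancels.\<close>

lemma prod_D_sym_diff:
  assumes "S \<subseteq> E" "T \<subseteq> E"
    and "square_upto_sign (prod D S)" "square_upto_sign (prod D T)"
  shows "square_upto_sign (prod D (S - T \<union> (T - S)))"
proof -
  have fin: "finite S" "finite T"
    using assms finite_E by (auto intro: finite_subset)
  have "prod D S = prod D (S - T) * prod D (S \<inter> T)"
    using fin by (metis prod.Int_Diff mult.commute)
  moreover have "prod D T = prod D (T - S) * prod D (S \<inter> T)"
    using fin by (metis prod.Int_Diff mult.commute Int_commute)
  moreover have "prod D (S - T \<union> (T - S)) = prod D (S - T) * prod D (T - S)"
    using fin by (intro prod.union_disjoint) auto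
  ultimately have "prod D S * prod D T = prod D (S - T \<union> (T - S)) * (prod D (S \<inter> T))\<^sup>2"
    by (simp add: power2_eq_square mult_ac)
  moreover have "prod D (S \<inter> T) \<noteq> 0"
    using fin assms D_neq_0 by auto
  ultimately show ?thesis
    using assms square_upto_sign_mult square_upto_sign_cancel by metis
qed

text \<open>The symmetric difference of \<open>S\<close> and its image under the transposition,
  phrased by membership so that adjacency can be read off.\<close>

definition moved_edges :: "'i \<Rightarrow> 'i \<Rightarrow> 'i set set \<Rightarrow> 'i set set" where
  "moved_edges a b S = {Y \<in> E. (Y \<in> S) \<noteq> (transpose a b ` Y \<in> S)}"

lemma prod_D_moved_edges:
  assumes "S \<subseteq> E" "a \<in> V" "b \<in> V" "square_upto_sign (prod D S)"
  shows "square_upto_sign (prod D (moved_edges a b S))"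
proof -
  let ?t = "transpose a b"
  have t: "?t permutes V" using assms by simp
  have inv: "?t ` ?t ` Y = Y" for Y by (simp add: image_comp)
  have "moved_edges a b S = S - (`) ?t ` S \<union> ((`) ?t ` S - S)"
  proof -
    have "Y \<in> (`) ?t ` S \<longleftrightarrow> ?t ` Y \<in> S" for Y
    proof
      assume "Y \<in> (`) ?t ` S"
      then obtain Z where "Z \<in> S" "Y = ?t ` Z" by blast
      then show "?t ` Y \<in> S" by (simp only: inv)
    next
      assume "?t ` Y \<in> S"
      then have "?t ` ?t ` Y \<in> (`) ?t ` S" by (rule imageI)
      then show "Y \<in> (`) ?t ` S" by (simp only: inv)
    qed
    then show ?thesis
      unfolding moved_edges_def using assms(1) inv image_in_E[OF t] by blast
  qed
  moreover have "square_upto_sign (prod D ((`) ?t ` S))"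
    using g_prod_D[OF t assms(1)] g_square_upto_sign[OF t assms(4)] square_upto_sign_cong by blast
  ultimately show ?thesis
    using prod_D_sym_diff[of S "(`) ?t ` S"] assms image_in_E[OF t] by auto
qed

lemma moved_edges_iff:
  "u \<in> V \<Longrightarrow> v \<in> V \<Longrightarrow> u \<noteq> v \<Longrightarrow>
    {u, v} \<in> moved_edges a b S \<longleftrightarrow> ({u, v} \<in> S) \<noteq> ({transpose a b u, transpose a b v} \<in> S)"
  unfolding moved_edges_def by (auto simp: E_iff)

text \<open>Exchanging two vertices with different neighbours leaves a complete bipartite graph with
  these two on one side. If the other side misses some vertex, a second exchange leaves a
  four-cycle.\<close>

theorem prod_D_not_square:
  assumes S: "S \<subseteq> E" "S \<noteq> {}"
  shows "\<not> square_upto_sign (prod D S)"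
proof
  assume sq: "square_upto_sign (prod D S)"
  \<comment> \<open>In the first case any two vertices have the same neighbours among the others, so
    a single edge propagates to all.\<close>
  consider (const) "\<And>a b c. \<lbrakk>a \<in> V; b \<in> V; c \<in> V; c \<noteq> a; c \<noteq> b\<rbrakk> \<Longrightarrow> {a, c} \<in> S \<Longrightarrow> {b, c} \<in> S"
    | (nonconst) a b c where "a \<in> V" "b \<in> V" "c \<in> V" "a \<noteq> b" "c \<noteq> a" "c \<noteq> b"
        "({a, c} \<in> S) \<noteq> ({b, c} \<in> S)"
    by metis
  then show False
  proof cases
    case const
    obtain Y where "Y \<in> S" using S by blast
    then obtain u v where uv: "{u, v} \<in> S" "u \<in> V" "v \<in> V" "u \<noteq> v"
      using S by (metis E_iff subsetD)
    have "{x, y} \<in> S" if "x \<in> V" "y \<in> V" "x \<noteq> y" for x y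
    proof (cases "x = v")
      case True
      then show ?thesis using const[of u y v] uv that by (simp add: insert_commute)
    next
      case False
      then have "{v, x} \<in> S"
        using const[of u x v] uv that by (metis insert_commute)
      then show ?thesis using const[of v y x] uv that False by (simp add: insert_commute)
    qed
    then have "S = E"
      using S(1) by (fastforce simp: E_iff)
    then show False
      using sq complete_not_square by (simp add: \<delta>_eq_prod_D)
  next
    case nonconst
    let ?T = "moved_edges a b S"
    \<comment> \<open>\<open>?T\<close> joins every vertex of \<open>C\<close> to both
      \<open>a\<close> and \<open>b\<close> and has no other edges.\<close>
    define C where "C = {x \<in> V - {a, b}. ({a, x} \<in> S) \<noteq> ({b, x} \<in> S)}"
    have T_sub: "?T \<subseteq> E" by (auto simp: moved_edges_def)
    have T_sq: "square_upto_sign (prod D ?T)"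
      using prod_D_moved_edges S sq nonconst by blast
    have T_iff: "{u, v} \<in> ?T \<longleftrightarrow> u \<in> {a, b} \<and> v \<in> C \<or> v \<in> {a, b} \<and> u \<in> C"
      if "u \<in> V" "v \<in> V" "u \<noteq> v" for u v
      using that nonconst(4)
      by (auto simp: moved_edges_iff C_def transpose_def insert_commute)
    have c: "c \<in> C" using nonconst by (auto simp: C_def)
    show False
    proof (cases "C = V - {a, b}")
      case True
      have "?T = (\<lambda>x. {a, x}) ` C \<union> (\<lambda>x. {b, x}) ` C"
      proof (intro Set.set_eqI iffI)
        fix Y assume Y: "Y \<in> ?T"
        then obtain u v where "Y = {u, v}" "u \<in> V" "v \<in> V" "u \<noteq> v"
          using T_sub by (meson E_iff subsetD)
        then show "Y \<in> (\<lambda>x. {a, x}) ` C \<union> (\<lambda>x. {b, x}) ` C"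
          using Y T_iff[of u v] by (auto simp: insert_commute)
      next
        fix Y assume "Y \<in> (\<lambda>x. {a, x}) ` C \<union> (\<lambda>x. {b, x}) ` C"
        then show "Y \<in> ?T"
          using nonconst T_iff[of a] T_iff[of b] by (auto simp: C_def)
      qed
      moreover have "prod D ((\<lambda>x. {a, x}) ` C \<union> (\<lambda>x. {b, x}) ` C) =
          prod D ((\<lambda>x. {a, x}) ` C) * prod D ((\<lambda>x. {b, x}) ` C)"
      proof (rule prod.union_disjoint)
        show "finite ((\<lambda>x. {a, x}) ` C)" "finite ((\<lambda>x. {b, x}) ` C)"
          using finite_V by (simp_all add: C_def)
        have "b \<notin> C" by (simp add: C_def)
        then show "(\<lambda>x. {a, x}) ` C \<inter> (\<lambda>x. {b, x}) ` C = {}"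
          using nonconst(4) by (auto simp: doubleton_eq_iff)
      qed
      moreover have "prod D ((\<lambda>x. {w, x}) ` C) = (\<Prod>x\<in>C. D {w, x})" for w
        by (subst prod.reindex) (auto simp: inj_on_def doubleton_eq_iff)
      ultimately have "prod D ?T = (\<Prod>x\<in>C. D {a, x} * D {b, x})"
        by (simp add: prod.distrib)
      moreover have "eq_upto_sign \<dots> (\<Prod>x\<in>C. (\<alpha> x - \<alpha> a) * (\<alpha> x - \<alpha> b))"
        using D_eq_upto_sign by (intro eq_upto_sign_prod eq_upto_sign_mult) (metis insert_commute)+
      ultimately show False
        using T_sq even_cut_not_square nonconst True square_upto_sign_cong by metis
    next
      case False
      then obtain e where e: "e \<in> V" "e \<notin> {a, b}" "e \<notin> C" by (auto simp: C_def)
      \<comment> \<open>Exchanging \<open>c\<close> in \<open>C\<close> with \<open>e\<close>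
        outside \<open>C\<close> changes only the four edges joining \<open>a\<close>,
        \<open>b\<close> to \<open>c\<close>, \<open>e\<close>.\<close>
      let ?U = "moved_edges c e ?T"
      have dist: "a \<noteq> b" "a \<noteq> c" "a \<noteq> e" "b \<noteq> c" "b \<noteq> e" "c \<noteq> e"
        using nonconst e c by auto
      have U_iff: "{u, v} \<in> ?U \<longleftrightarrow> u \<in> {a, b} \<and> v \<in> {c, e} \<or> v \<in> {a, b} \<and> u \<in> {c, e}"
        if uv: "u \<in> V" "v \<in> V" "u \<noteq> v" for u v
      proof -
        have "a \<notin> C" "b \<notin> C" by (auto simp: C_def)
        moreover have tr: "transpose c e u \<in> V" "transpose c e v \<in> V" "transpose c e u \<noteq> transpose c e v"
          using uv e nonconst by (auto simp: transpose_def)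
        ultimately show ?thesis
          unfolding moved_edges_iff[OF uv, of c e ?T] T_iff[OF uv] T_iff[OF tr]
          using uv(3) e(3) c dist by (auto simp: transpose_def)
      qed
      have "?U = {{a, c}, {b, c}, {a, e}, {b, e}}"
      proof (intro Set.set_eqI iffI)
        fix Y assume Y: "Y \<in> ?U"
        then obtain u v where "Y = {u, v}" "u \<in> V" "v \<in> V" "u \<noteq> v"
          by (auto simp: moved_edges_def E_iff)
        then show "Y \<in> {{a, c}, {b, c}, {a, e}, {b, e}}"
          using Y U_iff[of u v] by (auto simp: insert_commute)
      next
        fix Y assume "Y \<in> {{a, c}, {b, c}, {a, e}, {b, e}}"
        then show "Y \<in> ?U"
          using nonconst e dist U_iff by auto
      qed
      then have "prod D ?U = D {a, c} * D {b, c} * (D {a, e} * D {b, e})"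
        using dist by (simp add: doubleton_eq_iff mult.assoc)
      moreover have "eq_upto_sign \<dots>
          ((\<alpha> c - \<alpha> a) * (\<alpha> c - \<alpha> b) * ((\<alpha> e - \<alpha> a) * (\<alpha> e - \<alpha> b)))"
        using D_eq_upto_sign by (intro eq_upto_sign_mult) (metis insert_commute)+
      moreover have "square_upto_sign (prod D ?U)"
        using prod_D_moved_edges[OF T_sub] T_sq nonconst e by blast
      ultimately show False
        using four_cycle_not_square[of a b c e] nonconst e dist square_upto_sign_cong
        by (metis distinct_length_2_or_more distinct_singleton)
    qed
  qed
qed

corollary prod_pairs_not_square:
  assumes "S \<subseteq> pairs" "S \<noteq> {}"
  shows "\<not> (\<exists>y. (\<Prod>(i, j)\<in>S. \<alpha> j - \<alpha> i) = y\<^sup>2)"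
proof -
  have "(\<lambda>(i, j). {i, j}) ` S \<subseteq> E"
    using bij_betw_pairs_E assms(1) by (auto simp: bij_betw_def)
  then have "\<not> square_upto_sign (\<Prod>(i, j)\<in>S. \<alpha> j - \<alpha> i)"
    using prod_D_not_square assms by (simp add: prod_pairs_eq_prod_D)
  then show ?thesis
    by (auto simp: square_upto_sign_def eq_upto_sign_def)
qed

end

section \<open>Square classes\<close>

lemma square_class_mult:
  assumes "x \<noteq> 0" "y \<noteq> 0"
  shows "square_class x \<otimes>\<^bsub>square_class_group\<^esub> square_class y = square_class (x * y)"
proof -
  interpret G: comm_group "nonzero_group :: 'a monoid" by (rule comm_group_nonzero_group)
  interpret N: normal "nonzero_squares :: 'a set" nonzero_group
    by (rule G.subgroup_imp_normal[OF subgroup_nonzero_squares])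
  show ?thesis
    using N.rcos_sum[of x y] assms by (simp add: square_class_group_def square_class_def)
qed

lemma one_square_class_group: "\<one>\<^bsub>square_class_group\<^esub> = square_class 1"
proof -
  interpret G: comm_group "nonzero_group :: 'a monoid" by (rule comm_group_nonzero_group)
  show ?thesis
    using G.coset_join2[OF _ subgroup_nonzero_squares, of 1, symmetric]
      subgroup.one_closed[OF subgroup_nonzero_squares]
    by (simp add: square_class_group_def square_class_def)
qed

lemma square_class_closed: "x \<noteq> 0 \<Longrightarrow> square_class x \<in> carrier square_class_group"
  by (auto simp: square_class_group_def square_class_def FactGroup_def RCOSETS_def)

lemma square_class_eq_one_iff:
  assumes "x \<noteq> 0"
  shows "square_class x = \<one>\<^bsub>square_class_group\<^esub> \<longleftrightarrow> x \<in> nonzero_squares"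
proof -
  interpret G: comm_group "nonzero_group :: 'a monoid" by (rule comm_group_nonzero_group)
  show ?thesis
    using G.coset_join1[OF _ _ subgroup_nonzero_squares] G.coset_join2[OF _ subgroup_nonzero_squares]
      assms by (auto simp: square_class_group_def square_class_def)
qed

text \<open>This turns a linear combination over the field of two elements into the class of one
  product, taken over the support of the exponents.\<close>

lemma finprod_square_class:
  fixes x :: "'i \<Rightarrow> 'a::Fields.field"
  assumes "finite S" "\<And>i. i \<in> S \<Longrightarrow> x i \<noteq> 0" "\<And>i. i \<in> S \<Longrightarrow> c i \<in> {0, 1 :: nat}"
  shows "finprod square_class_group (\<lambda>i. square_class (x i) [^]\<^bsub>square_class_group\<^esub> c i) S =
    square_class (\<Prod>i | i \<in> S \<and> c i = 1. x i)"
proof -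
  interpret G: comm_group "square_class_group :: 'a set monoid"
    by (rule comm_group_square_class_group)
  show ?thesis
    using assms
  proof (induction S rule: finite_induct)
    case empty
    then show ?case by (simp add: one_square_class_group)
  next
    case (insert i S)
    have [simp]: "(\<lambda>i. square_class (x i) [^]\<^bsub>square_class_group\<^esub> c i) \<in> S \<rightarrow> carrier square_class_group"
      using insert by (auto simp: square_class_closed)
    have fp: "finprod square_class_group (\<lambda>i. square_class (x i) [^]\<^bsub>square_class_group\<^esub> c i) (insert i S) =
        square_class (x i) [^]\<^bsub>square_class_group\<^esub> c i \<otimes>\<^bsub>square_class_group\<^esub>
        square_class (\<Prod>i | i \<in> S \<and> c i = 1. x i)"
      using insert by (simp add: square_class_closed)
    have nz: "(\<Prod>i | i \<in> S \<and> c i = 1. x i) \<noteq> 0" using insert by auto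
    have "c i = 0 \<or> c i = 1" using insert.prems by auto
    then show ?case
    proof
      assume c: "c i = 0"
      then have "{j. j \<in> insert i S \<and> c j = 1} = {j. j \<in> S \<and> c j = 1}" by auto
      then show ?thesis using fp c nz by (simp add: square_class_closed)
    next
      assume c: "c i = 1"
      then have "{j. j \<in> insert i S \<and> c j = 1} = insert i {j. j \<in> S \<and> c j = 1}" by auto
      then show ?thesis
        using fp c nz insert by (simp add: square_class_closed square_class_mult)
    qed
  qed
qed

section \<open>Splitting fields with symmetric Galois group\<close>

lemma ring_hom_of_types_iff:
  "\<sigma> \<in> ring_hom (ring_of_type_algebra :: 'k::Fields.field ring) (ring_of_type_algebra :: 'l::Fields.field ring) \<longleftrightarrow>
    \<sigma> 1 = 1 \<and> (\<forall>x y. \<sigma> (x + y) = \<sigma> x + \<sigma> y) \<and> (\<forall>x y. \<sigma> (x * y) = \<sigma> x * \<sigma> y)"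
  by (auto simp: ring_hom_def ring_of_type_algebra_def)

lemma galois_automorphisms_endo: "\<sigma> \<in> galois_automorphisms \<iota> \<Longrightarrow> ring_endo \<sigma>"
  by (simp add: galois_automorphisms_def ring_iso_def ring_hom_of_types_iff ring_endo_def)

text \<open>Minimality of the generated field, translated from the record operations to those of the
  type class.\<close>

lemma generate_field_of_type_subset:
  fixes F H :: "'l::Fields.field set"
  assumes F: "subring_set F" "\<And>x. x \<in> F \<Longrightarrow> inverse x \<in> F" and H: "H \<subseteq> F"
  shows "generate_field ring_of_type_algebra H \<subseteq> F"
proof
  interpret R: Ring.field "ring_of_type_algebra :: 'l ring" by (rule field_from_type_algebra)
  have minus: "\<ominus>\<^bsub>ring_of_type_algebra\<^esub> x = - x" for x :: 'l
    by (rule R.minus_equality) (auto simp: ring_of_type_algebra_def)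
  have inv: "inv\<^bsub>ring_of_type_algebra\<^esub> x = inverse x" if "x \<noteq> 0" for x :: 'l
    by (rule R.comm_inv_char) (use that in \<open>auto simp: ring_of_type_algebra_def\<close>)
  fix x assume "x \<in> generate_field (ring_of_type_algebra :: 'l ring) H"
  then show "x \<in> F"
  proof induction
    case one
    then show ?case using F by (simp add: ring_of_type_algebra_def subring_set_def)
  next
    case (m_inv h)
    then have "h \<noteq> 0" by (simp add: ring_of_type_algebra_def)
    then show ?case using m_inv F by (simp add: inv)
  next
    case (eng_add x y)
    then show ?case using F by (simp add: ring_of_type_algebra_def subring_set_def)
  next
    case (eng_mult x y)
    then show ?case using F by (simp add: ring_of_type_algebra_def subring_set_def)
  qed (use F H in \<open>auto simp: minus subring_set_def\<close>)
qed

text \<open>The leading terms cancel in the difference, which would have \<open>card I\<close> roots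
  but smaller degree if it were nonzero.\<close>

lemma poly_eq_prod_roots:
  fixes p :: "'l::Fields.field poly"
  assumes I: "finite I" "inj_on \<alpha> I" and p: "Polynomial.degree p = card I"
    and roots: "\<And>i. i \<in> I \<Longrightarrow> poly p (\<alpha> i) = 0"
  shows "p = Polynomial.smult (lead_coeff p) (\<Prod>i\<in>I. [:- \<alpha> i, 1:])"
proof (rule ccontr)
  let ?h = "\<Prod>i\<in>I. [:- \<alpha> i, 1:]"
  let ?q = "p - Polynomial.smult (lead_coeff p) ?h"
  assume "p \<noteq> Polynomial.smult (lead_coeff p) ?h"
  then have nz: "?q \<noteq> 0" by simp
  have deg: "Polynomial.degree ?h = card I"
    by (subst degree_prod_eq_sum_degree) auto
  have lc: "lead_coeff ?h = 1"
    by (subst lead_coeff_prod) simp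
  have "Polynomial.degree ?q < Polynomial.degree p"
  proof (rule degree_less_if_less_eqI[OF _ _ nz])
    show "Polynomial.degree ?q \<le> Polynomial.degree p"
      using deg p by (intro degree_diff_le order.trans[OF degree_smult_le]) auto
    show "poly.coeff ?q (Polynomial.degree p) = 0"
      using lc deg p by simp
  qed
  also have "\<dots> = card (\<alpha> ` I)" using p card_image[OF I(2)] by simp
  also have "\<dots> \<le> card {x. poly ?q x = 0}"
    using I roots by (intro card_mono poly_roots_finite nz) (auto simp: poly_prod)
  also have "\<dots> \<le> Polynomial.degree ?q"
    by (rule card_poly_roots_bound[OF nz])
  finally show False by simp
qed

text \<open>Transporting \<open>\<pi>\<close> along the bijection \<open>\<alpha>\<close> gives a
  permutation of the roots, hence the restriction of an automorphism.\<close>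

lemma ex_galois_lift:
  assumes "galois_group_full_symmetric \<iota> f" and bij: "bij_betw \<alpha> I (poly_roots_in \<iota> f)"
    and \<pi>: "\<pi> permutes I"
  shows "\<exists>\<sigma>\<in>galois_automorphisms \<iota>. \<forall>i\<in>I. \<sigma> (\<alpha> i) = \<alpha> (\<pi> i)"
proof -
  let ?Z = "poly_roots_in \<iota> f"
  define \<rho> where "\<rho> = (\<lambda>x. if x \<in> ?Z then \<alpha> (\<pi> (inv_into I \<alpha> x)) else x)"
  have "\<rho> permutes ?Z"
    unfolding \<rho>_def by (rule permutes_bij_inv_into[OF \<pi> bij])
  then obtain \<sigma> where \<sigma>: "\<sigma> \<in> galois_automorphisms \<iota>" "\<rho> = (\<lambda>x. if x \<in> ?Z then \<sigma> x else x)"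
    using assms(1) unfolding galois_group_full_symmetric_def by blast
  have "\<sigma> (\<alpha> i) = \<alpha> (\<pi> i)" if "i \<in> I" for i
  proof -
    have "\<alpha> i \<in> ?Z" using bij that by (auto simp: bij_betw_def)
    then have "\<sigma> (\<alpha> i) = \<rho> (\<alpha> i)" by (simp add: \<sigma>(2))
    also have "\<dots> = \<alpha> (\<pi> i)"
      using \<open>\<alpha> i \<in> ?Z\<close> that bij by (simp add: \<rho>_def bij_betw_def inv_into_f_f)
    finally show ?thesis .
  qed
  with \<sigma>(1) show ?thesis by blast
qed

text \<open>The elements on which two endomorphisms agree form a subfield.\<close>

lemma ring_endo_eqI:
  fixes \<sigma> \<tau> :: "'l::Fields.field \<Rightarrow> 'l"
  assumes \<sigma>: "ring_endo \<sigma>" and \<tau>: "ring_endo \<tau>"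
    and gen: "generate_field ring_of_type_algebra H = UNIV"
    and eq: "\<And>x. x \<in> H \<Longrightarrow> \<sigma> x = \<tau> x"
  shows "\<sigma> x = \<tau> x"
proof -
  let ?F = "{x. \<sigma> x = \<tau> x}"
  have "generate_field ring_of_type_algebra H \<subseteq> ?F"
  proof (rule generate_field_of_type_subset)
    show "subring_set ?F"
      using \<sigma> \<tau> by (simp add: subring_set_def ring_endo_1 ring_endo_minus ring_endo_add ring_endo_mult)
  qed (use \<sigma> \<tau> eq in \<open>auto simp: ring_endo_inverse\<close>)
  then show ?thesis using gen by auto
qed

theorem theorem6p1:
  fixes \<iota> :: "'k::Fields.field \<Rightarrow> 'l::Fields.field"
    and f :: "'k poly" and d :: nat and \<alpha> :: "nat \<Rightarrow> 'l"
  assumes "CHAR('k) \<noteq> 2"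
    and "Polynomial.degree f = d" and "even d" and "d \<ge> 6"
    and "is_splitting_field \<iota> f"
    and "rsquarefree (map_poly \<iota> f)"
    and "galois_group_full_symmetric \<iota> f"
    and "bij_betw \<alpha> {1..d} (poly_roots_in \<iota> f)"
    and "discriminant (\<iota> (lead_coeff f)) d \<alpha> \<notin> {- (\<iota> a)\<^sup>2 | a. True}"
  shows "F2_independent square_class_group (index_pairs d)
           (\<lambda>(i, j). square_class (\<alpha> j - \<alpha> i)) \<and>
         (\<forall>T. T \<subseteq> {\<alpha> j - \<alpha> i | i j. (i, j) \<in> index_pairs d} \<and> T \<noteq> {} \<longrightarrow>
            \<not> (\<exists>y. (\<Prod>x\<in>T. x) = y\<^sup>2))"
proof -
  have \<iota>_1: "\<iota> 1 = 1" and \<iota>_add: "\<And>x y. \<iota> (x + y) = \<iota> x + \<iota> y"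
    and \<iota>_mult: "\<And>x y. \<iota> (x * y) = \<iota> x * \<iota> y"
    using assms(5) by (simp_all add: is_splitting_field_def ring_hom_of_types_iff)
  have \<iota>_0: "\<iota> 0 = 0" using \<iota>_add[of 0 0] by (metis add.right_neutral add_left_cancel)
  have \<iota>_minus: "\<iota> (- x) = - \<iota> x" for x
    using \<iota>_add[of x "- x"] by (simp add: \<iota>_0 eq_neg_iff_add_eq_0 add.commute)
  have \<iota>_neq_0: "\<iota> x \<noteq> 0" if "x \<noteq> 0" for x
    using \<iota>_mult[of x "inverse x"] that by (auto simp: \<iota>_1)
  have \<iota>_inverse: "\<iota> (inverse x) = inverse (\<iota> x)" for x
    using \<iota>_mult[of x "inverse x"] \<iota>_1 \<iota>_0
    by (cases "x = 0") (auto intro: inverse_unique[symmetric])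
  have \<iota>_power: "\<iota> (x ^ n) = \<iota> x ^ n" for x n
    by (induction n) (simp_all add: \<iota>_1 \<iota>_mult)
  have two: "(2 :: 'l) \<noteq> 0"
  proof
    assume *: "(2 :: 'l) = 0"
    have "\<iota> (1 + 1) = 1 + 1" by (simp only: \<iota>_add \<iota>_1)
    then have "\<iota> 2 = 0" using * by (simp only: one_add_one)
    \<comment> \<open>\<open>\<iota>\<close> maps nonzero elements to nonzero elements, so 2 already
      vanishes in the base field, whose characteristic then divides 2.\<close>
    then have "of_nat 2 = (0 :: 'k)" using \<iota>_neq_0 by fastforce
    then have "CHAR('k) dvd 2" by (simp only: of_nat_eq_0_iff_char_dvd)
    then have "CHAR('k) = 1 \<or> CHAR('k) = 2"
      using prime_nat_iff[of 2] two_is_prime_nat by blast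
    then show False using assms(1) by simp
  qed
  let ?Z = "poly_roots_in \<iota> f"
  define c where "c = \<iota> (lead_coeff f)"
  have f0: "f \<noteq> 0" using assms(2,4) by auto
  then have c0: "c \<noteq> 0" by (simp add: c_def \<iota>_neq_0)
  have deg: "Polynomial.degree (map_poly \<iota> f) = d"
    using assms(2) c0 by (subst degree_map_poly) (simp_all add: c_def \<iota>_neq_0)
  have inj: "inj_on \<alpha> {1..d}" and image: "\<alpha> ` {1..d} = ?Z"
    using assms(8) by (simp_all add: bij_betw_def)
  have fprod: "map_poly \<iota> f = Polynomial.smult c (\<Prod>i\<in>{1..d}. [:- \<alpha> i, 1:])"
  proof -
    have "lead_coeff (map_poly \<iota> f) = c"
      using deg assms(2) by (simp add: coeff_map_poly \<iota>_0 c_def)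
    moreover have "poly (map_poly \<iota> f) (\<alpha> i) = 0" if "i \<in> {1..d}" for i
      using image that by (auto simp: poly_roots_in_def)
    ultimately show ?thesis
      using poly_eq_prod_roots[of "{1..d}" \<alpha> "map_poly \<iota> f"] deg inj by simp
  qed
  have gen: "generate_field ring_of_type_algebra (range \<iota> \<union> \<alpha> ` {1..d}) = UNIV"
    using assms(5) image by (simp add: is_splitting_field_def)
  \<comment> \<open>The lifts are chosen separately for each permutation; they respect composition
    because an automorphism over the base field is determined by its values on the roots.\<close>
  define g where "g \<pi> = (SOME \<sigma>. \<sigma> \<in> galois_automorphisms \<iota> \<and> (\<forall>i\<in>{1..d}. \<sigma> (\<alpha> i) = \<alpha> (\<pi> i)))" for \<pi>
  have g: "g \<pi> \<in> galois_automorphisms \<iota>" "\<And>i. i \<in> {1..d} \<Longrightarrow> g \<pi> (\<alpha> i) = \<alpha> (\<pi> i)"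
    if "\<pi> permutes {1..d}" for \<pi>
  proof -
    have "\<exists>\<sigma>. \<sigma> \<in> galois_automorphisms \<iota> \<and> (\<forall>i\<in>{1..d}. \<sigma> (\<alpha> i) = \<alpha> (\<pi> i))"
      using ex_galois_lift[OF assms(7,8) that] by blast
    from someI_ex[OF this] show "g \<pi> \<in> galois_automorphisms \<iota>"
      "\<And>i. i \<in> {1..d} \<Longrightarrow> g \<pi> (\<alpha> i) = \<alpha> (\<pi> i)"
      by (simp_all add: g_def)
  qed
  have endo: "ring_endo (g \<pi>)" if "\<pi> permutes {1..d}" for \<pi>
    by (rule galois_automorphisms_endo[OF g(1)[OF that]])
  have g_\<iota>: "g \<pi> (\<iota> x) = \<iota> x" if "\<pi> permutes {1..d}" for \<pi> x
    using g(1)[OF that] by (simp add: galois_automorphisms_def)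
  interpret symmetric_galois "range \<iota>" \<alpha> d g
  proof
    show "subring_set (range \<iota>)"
      using rangeI[of \<iota> 1]
      by (auto simp: subring_set_def \<iota>_1 simp flip: \<iota>_minus \<iota>_add \<iota>_mult)
    show "inverse x \<in> range \<iota>" if "x \<in> range \<iota>" for x
      using that by (auto simp flip: \<iota>_inverse)
    show "inj_on \<alpha> {1..d}" by (rule inj)
    show "poly_over (range \<iota>) (\<Prod>i\<in>{1..d}. [:- \<alpha> i, 1:])"
      unfolding poly_over_def
    proof
      fix n
      let ?h = "\<Prod>i\<in>{1..d}. [:- \<alpha> i, 1:]"
      have "\<iota> (poly.coeff f n) = c * poly.coeff ?h n"
        using arg_cong[OF fprod, of "\<lambda>p. poly.coeff p n"] by (simp add: coeff_map_poly \<iota>_0)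
      then have "poly.coeff ?h n = \<iota> (inverse (lead_coeff f) * poly.coeff f n)"
        using c0 by (simp add: \<iota>_mult \<iota>_inverse c_def)
      then show "poly.coeff ?h n \<in> range \<iota>" by simp
    qed
    show "g \<pi> x = x" if "\<pi> permutes {1..d}" "x \<in> range \<iota>" for \<pi> x
      using that g_\<iota> by auto
    show "g (\<pi> \<circ> \<rho>) x = g \<pi> (g \<rho> x)"
      if \<pi>: "\<pi> permutes {1..d}" and \<rho>: "\<rho> permutes {1..d}" for \<pi> \<rho> x
    proof (rule ring_endo_eqI[OF _ _ gen, where \<sigma> = "g (\<pi> \<circ> \<rho>)" and \<tau> = "\<lambda>x. g \<pi> (g \<rho> x)"])
      have \<pi>\<rho>: "\<pi> \<circ> \<rho> permutes {1..d}" by (rule permutes_compose[OF \<rho> \<pi>])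
      show "ring_endo (g (\<pi> \<circ> \<rho>))" by (rule endo[OF \<pi>\<rho>])
      show "ring_endo (\<lambda>x. g \<pi> (g \<rho> x))"
        using endo[OF \<pi>] endo[OF \<rho>] by (simp add: ring_endo_def)
      show "g (\<pi> \<circ> \<rho>) y = g \<pi> (g \<rho> y)" if "y \<in> range \<iota> \<union> \<alpha> ` {1..d}" for y
      proof -
        have "g (\<pi> \<circ> \<rho>) (\<alpha> i) = g \<pi> (g \<rho> (\<alpha> i))" if "i \<in> {1..d}" for i
          using g(2)[OF \<pi>\<rho> that] g(2)[OF \<rho> that] g(2)[OF \<pi>, of "\<rho> i"]
            permutes_in_image[OF \<rho>, of i] that by simp
        then show ?thesis
          using that g_\<iota>[OF \<pi>\<rho>] g_\<iota>[OF \<pi>] g_\<iota>[OF \<rho>] by (elim UnE rangeE imageE) simp_all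
      qed
    qed
    show "g id x = x" for x
    proof (rule ring_endo_eqI[OF _ _ gen, where \<sigma> = "g id" and \<tau> = "\<lambda>x. x"])
      show "ring_endo (g id)" by (rule endo[OF permutes_id])
      show "ring_endo (\<lambda>x. x)" by (simp add: ring_endo_def)
      show "g id y = y" if "y \<in> range \<iota> \<union> \<alpha> ` {1..d}" for y
        using that g_\<iota>[OF permutes_id] g(2)[OF permutes_id] by auto
    qed
    show "F = UNIV" if "subring_set F" "\<And>x. x \<in> F \<Longrightarrow> inverse x \<in> F" "range \<iota> \<subseteq> F" "\<alpha> ` {1..d} \<subseteq> F" for F
      using generate_field_of_type_subset[OF that(1,2), of "range \<iota> \<union> \<alpha> ` {1..d}"] that(3,4) gen
      by blast
  qed (use g endo in auto)
  have pairs_eq: "index_pairs d = {(i, j). i \<in> {1..d} \<and> j \<in> {1..d} \<and> i < j}"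
    by (auto simp: index_pairs_def)
  interpret symmetric_action "{1..d}" \<alpha> g
  proof
    show "\<exists>a\<in>{1..d}. \<exists>b\<in>{1..d}. g (transpose a b) z \<noteq> z"
      if z: "z\<^sup>2 = - (\<Prod>(i, j)\<in>{(i, j). i \<in> {1..d} \<and> j \<in> {1..d} \<and> i < j}. \<alpha> j - \<alpha> i)\<^sup>2" for z
    proof (rule ccontr)
      assume "\<not> ?thesis"
      then obtain k where k: "z = \<iota> k" using fixed_in_base[of z] by blast
      have "discriminant c d \<alpha> = c ^ (2 * d - 2) * (\<Prod>(i, j)\<in>index_pairs d. \<alpha> j - \<alpha> i)\<^sup>2"
        by (simp add: discriminant_def prod_power_distrib case_prod_unfold)
      also have "\<dots> = - (c ^ (2 * d - 2) * z\<^sup>2)"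
        by (simp only: z pairs_eq minus_minus mult_minus_right)
      \<comment> \<open>The exponent of the leading coefficient is even, so this power is absorbed
        into the square.\<close>
      also have "2 * d - 2 = (d - 1) * 2" by simp
      also have "- (c ^ ((d - 1) * 2) * z\<^sup>2) = - (\<iota> (lead_coeff f ^ (d - 1) * k))\<^sup>2"
        by (simp only: k c_def \<iota>_mult \<iota>_power power_mult power_mult_distrib)
      finally show False using assms(9) by (auto simp: c_def)
    qed
  qed (use assms two inj endo g g_compose g_ident in \<open>auto simp: ring_endo_add ring_endo_mult ring_endo_1\<close>)
  have pairs: "pairs = index_pairs d" by (simp only: pairs_def pairs_eq)
  have nonzero: "\<alpha> j - \<alpha> i \<noteq> 0" if "(i, j) \<in> index_pairs d" for i j
    using that diff_neq_0[of j i] by (auto simp: index_pairs_def)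
  note not_square = prod_pairs_not_square[unfolded pairs]
  show ?thesis
  proof (intro conjI allI impI)
    show "F2_independent square_class_group (index_pairs d) (\<lambda>(i, j). square_class (\<alpha> j - \<alpha> i))"
      unfolding F2_independent_def
    proof (intro allI impI, elim conjE)
      fix S and e :: "nat \<times> nat \<Rightarrow> nat"
      assume S: "finite S" "S \<subseteq> index_pairs d" and e: "\<forall>i\<in>S. e i \<in> {0, 1}"
        and "finprod square_class_group (\<lambda>i. (case i of (i, j) \<Rightarrow> square_class (\<alpha> j - \<alpha> i))
          [^]\<^bsub>square_class_group\<^esub> e i) S = \<one>\<^bsub>square_class_group\<^esub>"
      then have one: "finprod square_class_group (\<lambda>p. square_class (\<alpha> (snd p) - \<alpha> (fst p))
          [^]\<^bsub>square_class_group\<^esub> e p) S = \<one>\<^bsub>square_class_group\<^esub>"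
        by (simp add: case_prod_unfold)
      let ?S = "{p. p \<in> S \<and> e p = 1}"
      have nz: "\<alpha> (snd p) - \<alpha> (fst p) \<noteq> 0" if "p \<in> S" for p
        using that S nonzero[of "fst p" "snd p"] by auto
      have "square_class (\<Prod>p\<in>?S. \<alpha> (snd p) - \<alpha> (fst p)) = \<one>\<^bsub>square_class_group\<^esub>"
        using one e nz by (subst (asm) finprod_square_class[OF S(1)]) auto
      moreover have "(\<Prod>p\<in>?S. \<alpha> (snd p) - \<alpha> (fst p)) \<noteq> 0"
        using S(1) nz by (subst prod_zero_iff) auto
      ultimately have "(\<Prod>p\<in>?S. \<alpha> (snd p) - \<alpha> (fst p)) \<in> nonzero_squares"
        by (simp add: square_class_eq_one_iff)
      then have "\<exists>y. (\<Prod>(i, j)\<in>?S. \<alpha> j - \<alpha> i) = y\<^sup>2"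
        by (auto simp: nonzero_squares_def case_prod_unfold)
      then have "?S = {}" using not_square[of ?S] S(2) by blast
      then show "\<forall>i\<in>S. e i = 0" using e by auto
    qed
  next
    fix T assume T: "T \<subseteq> {\<alpha> j - \<alpha> i |i j. (i, j) \<in> index_pairs d} \<and> T \<noteq> {}"
    then have "T \<subseteq> (\<lambda>(i, j). \<alpha> j - \<alpha> i) ` index_pairs d" by auto
    \<comment> \<open>\<open>T\<close> is a set of field elements; \<open>S\<close> picks one index
      pair for each, so that the product can be reindexed.\<close>
    then obtain S where S: "S \<subseteq> index_pairs d" "inj_on (\<lambda>(i, j). \<alpha> j - \<alpha> i) S"
        "T = (\<lambda>(i, j). \<alpha> j - \<alpha> i) ` S"
      by (auto simp: subset_image_inj)
    then have "(\<Prod>x\<in>T. x) = (\<Prod>(i, j)\<in>S. \<alpha> j - \<alpha> i)"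
      by (simp add: prod.reindex)
    then show "\<not> (\<exists>y. (\<Prod>x\<in>T. x) = y\<^sup>2)"
      using not_square[OF S(1)] S(3) T by auto
  qed
qed

end
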